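(* Given an unranked tree automaton $\mathcal{A}$ over a finite alphabet $\Sigma$ and a finite set $\mathcal{C}$ of set constraints and linear constraints, there exists a weak ODTA extended with a Presburger constraint $\langle\mathcal{S},\varphi\rangle$ such that the set of ordered-data trees accepted by $\langle\mathcal{S},\varphi\rangle$ is precisely the set of ordered-data trees $t$ such that $\mathrm{Proj}(t)$ is accepted by $\mathcal{A}$ and $t$ satisfies all constraints in $\mathcal{C}$. Moreover, the construction of $\langle\mathcal{S},\varphi\rangle$ takes exponential time in the size of $\mathcal{A}$ and $\mathcal{C}$.
   Context: An ordered-data tree over a finite alphabet $\Sigma$ is a finite unranked ordered tree in which each node carries a label in $\Sigma$ and a data value in $\mathbb{N}$; $\mathrm{Proj}(t)$ is $t$ without data values. For $t$ over an alphabet $\Gamma$, $V_t(a)$ is the set of data values of $a$-nodes, $V_t=\bigcup_a V_t(a)$, $[S]_t=\bigcap_{a\in S}V_t(a)\cap\bigcap_{b\notin S}\overline{V_t(b)}$ for $S\subseteq\Gamma$, and if $d_1<\dots<d_m$ are all data values of $t$, $\mathcal{V}_\Gamma(t)=S_1\cdots S_m$ over $2^\Gamma\setminus\{\emptyset\}$ with $d_i\in[S_i]_t$. Data terms: $\tau::=V(a)\mid\tau\cup\tau\mid\tau\cap\tau\mid\overline{\tau}$ ($a\in\Sigma$), interpreted in $t$ by $V(a)\mapsto V_t(a)$, $\overline\tau\mapsto V_t\setminus[\![\tau]\!]_t$, and $\cup,\cap$ as set operations. A set constraint is $\tau=\emptyset$ or $\tau\neq\emptyset$, satisfied by $t$ when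 $[\![\tau]\!]_t$ is (non)empty. A linear constraint is a linear constraint over variables $x_a$ ($a\in\Sigma$) and $z_S$ ($S\subseteq\Sigma$); $t$ satisfies it when it holds with $x_a$ the number of $a$-nodes of $t$ and $z_S=|[S]_t|$. A letter-to-letter tree transducer from $\Sigma$ to $\Gamma$ is an unranked tree automaton with an output relation $\mu\subseteq Q\times\Sigma\times\Gamma$; $t'$ is an output on $t$ if there is an accepting run $\rho$ on $t$ with $(\rho(u),\mathrm{lab}_t(u),\mathrm{lab}_{t'}(u))\in\mu$ at every node. A weak ODTA over $\Sigma$ is $\mathcal{S}=\langle\mathcal{T},\mathcal{M},\Gamma_0\rangle$ with $\mathcal{T}$ a letter-to-letter tree transducer from $\Sigma$ to $\Gamma=\{\alpha_1,\dots,\alpha_\ell\}$, $\mathcal{M}$ a finite string automaton over $2^\Gamma$, $\Gamma_0\subseteq\Gamma$. A weak ODTA extended with a Presburger constraint is $\langle\mathcal{S},\xi\rangle$ with $\xi(x_1,\dots,x_\ell,y_1,\dots,y_{2^\ell-1})$ an existential Presburger formula; it accepts $t$ iff there is an ordered-data tree $t'$ over $\Gamma$ that is an output of $\mathcal{T}$ on $\mathrm{Proj}(t)$ (carrying $t$'s data values) such that $\mathcal{M}$ accepts $\mathcal{V}_\Gamma(t')$, for each $a\in\Gamma_0$ the $a$-nodes of $t'$ have distinct data values, and $\xi(\mathrm{Parikh}(t'),\mathrm{Parikh}(\mathcal{V}_\Gamma(t')))$ holds (Parikh images count the occurrences of each label, of $\Gamma$ resp. of nonempty subsets of $\Gamma$).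 *)

theory Defs
  imports Main
begin

section \<open>Ordered-data trees\<close>

datatype 'l tree = Node (root: 'l) (children: "'l tree list")

primrec is_node :: "'l tree \<Rightarrow> nat list \<Rightarrow> bool" where
  "is_node t [] = True"
| "is_node t (i # u) = (i < length (children t) \<and> is_node (children t ! i) u)"

primrec subtree :: "'l tree \<Rightarrow> nat list \<Rightarrow> 'l tree" where
  "subtree t [] = t"
| "subtree t (i # u) = subtree (children t ! i) u"

definition nodes :: "'l tree \<Rightarrow> nat list set" where
  "nodes t = {u. is_node t u}"

definition lab :: "'l tree \<Rightarrow> nat list \<Rightarrow> 'l" where
  "lab t u = root (subtree t u)"

definition arity :: "'l tree \<Rightarrow> nat list \<Rightarrow> nat" where
  "arity t u = length (children (subtree t u))"

text \<open>The children of a node \<open>u\<close> are \<open>u @ [0], \<dots>, u @ [arity t u - 1]\<close>.\<close>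

type_synonym 'a odtree = "('a \<times> nat) tree"

definition Proj :: "'a odtree \<Rightarrow> 'a tree" where
  "Proj t = map_tree fst t"

definition Data :: "'a odtree \<Rightarrow> nat tree" where
  "Data t = map_tree snd t"

definition odtrees_over :: "'a set \<Rightarrow> 'a odtree set" where
  "odtrees_over \<Sigma> = {t. \<forall>u \<in> nodes t. fst (lab t u) \<in> \<Sigma>}"

definition label_nodes :: "'a odtree \<Rightarrow> 'a \<Rightarrow> nat list set" where
  "label_nodes t a = {u \<in> nodes t. fst (lab t u) = a}"

definition Vals :: "'a odtree \<Rightarrow> 'a \<Rightarrow> nat set" where
  "Vals t a = (\<lambda>u. snd (lab t u)) ` label_nodes t a"

definition all_vals :: "'a odtree \<Rightarrow> nat set" where
  "all_vals t = (\<Union>a. Vals t a)"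

text \<open>\<open>[S]\<^sub>t\<close> for a tree over \<open>\<Gamma>\<close>.  Complements are taken within the set of data values of the
  tree, as in data terms; this matters only for \<open>S = \<emptyset>\<close>, where \<open>[\<emptyset>]\<^sub>t = \<emptyset>\<close>.\<close>

definition Bracket :: "'a set \<Rightarrow> 'a odtree \<Rightarrow> 'a set \<Rightarrow> nat set" where
  "Bracket \<Gamma> t S = all_vals t \<inter> (\<Inter>a\<in>S. Vals t a) \<inter> (\<Inter>b\<in>\<Gamma> - S. all_vals t - Vals t b)"

definition value_word :: "'a set \<Rightarrow> 'a odtree \<Rightarrow> 'a set list" where
  "value_word \<Gamma> t =
     map (\<lambda>d. THE S. S \<subseteq> \<Gamma> \<and> d \<in> Bracket \<Gamma> t S) (sorted_list_of_set (all_vals t))"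

lemma Bracket_unique:
  assumes "d \<in> all_vals t"
  shows "\<exists>!S. S \<subseteq> \<Gamma> \<and> d \<in> Bracket \<Gamma> t S"
proof (rule ex1I[of _ "{a \<in> \<Gamma>. d \<in> Vals t a}"])
  show "{a \<in> \<Gamma>. d \<in> Vals t a} \<subseteq> \<Gamma> \<and> d \<in> Bracket \<Gamma> t {a \<in> \<Gamma>. d \<in> Vals t a}"
    using assms by (auto simp: Bracket_def)
next
  fix S assume "S \<subseteq> \<Gamma> \<and> d \<in> Bracket \<Gamma> t S"
  then show "S = {a \<in> \<Gamma>. d \<in> Vals t a}" by (auto simp: Bracket_def split: if_splits)
qed


section \<open>Linear constraints and existential Presburger formulas\<close>

datatype cmp = LE | LT | EQ | GE | GT

fun cmp_holds :: "cmp \<Rightarrow> int \<Rightarrow> int \<Rightarrow> bool" where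
  "cmp_holds LE x y = (x \<le> y)"
| "cmp_holds LT x y = (x < y)"
| "cmp_holds EQ x y = (x = y)"
| "cmp_holds GE x y = (x \<ge> y)"
| "cmp_holds GT x y = (x > y)"

datatype 'v lin = Lin "(int \<times> 'v) list" cmp int

fun lin_sat :: "('v \<Rightarrow> nat) \<Rightarrow> 'v lin \<Rightarrow> bool" where
  "lin_sat \<nu> (Lin ts r c) = cmp_holds r (\<Sum>(k, v)\<leftarrow>ts. k * int (\<nu> v)) c"

datatype 'v qfree = Atom "'v lin" | Neg "'v qfree"
  | Conj "'v qfree" "'v qfree" | Disj "'v qfree" "'v qfree"

primrec qfree_sat :: "('v \<Rightarrow> nat) \<Rightarrow> 'v qfree \<Rightarrow> bool" where
  "qfree_sat \<nu> (Atom l) = lin_sat \<nu> l"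
| "qfree_sat \<nu> (Neg f) = (\<not> qfree_sat \<nu> f)"
| "qfree_sat \<nu> (Conj f g) = (qfree_sat \<nu> f \<and> qfree_sat \<nu> g)"
| "qfree_sat \<nu> (Disj f g) = (qfree_sat \<nu> f \<or> qfree_sat \<nu> g)"

text \<open>In an existential formula the variables \<open>Inl v\<close> are free; the finitely many variables \<open>Inr i\<close>
  that occur are existentially quantified in front of the quantifier-free matrix.\<close>

datatype 'v expresb = Ex_prefix (matrix: "('v + nat) qfree")

definition expresb_sat :: "('v \<Rightarrow> nat) \<Rightarrow> 'v expresb \<Rightarrow> bool" where
  "expresb_sat \<nu> \<xi> = (\<exists>w :: nat \<Rightarrow> nat. qfree_sat (case_sum \<nu> w) (matrix \<xi>))"

definition free_vars :: "'v expresb \<Rightarrow> 'v set" where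
  "free_vars \<xi> = {v. Inl v \<in> set_qfree (matrix \<xi>)}"

text \<open>Variables indexed by letters (the \<open>x\<^sub>a\<close>) and by sets of letters (the \<open>z\<^sub>S\<close> of a linear
  constraint, the \<open>y\<^sub>S\<close> of a formula attached to a weak ODTA).\<close>

datatype 'a cvar = LetterVar 'a | SetVar "'a set"


section \<open>Set constraints and linear constraints on trees\<close>

datatype 'a dterm = V 'a | Cup "'a dterm" "'a dterm" | Cap "'a dterm" "'a dterm" | Compl "'a dterm"

primrec dterm_val :: "'a odtree \<Rightarrow> 'a dterm \<Rightarrow> nat set" where
  "dterm_val t (V a) = Vals t a"
| "dterm_val t (Cup x y) = dterm_val t x \<union> dterm_val t y"
| "dterm_val t (Cap x y) = dterm_val t x \<inter> dterm_val t y"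
| "dterm_val t (Compl x) = all_vals t - dterm_val t x"

datatype 'a constr = IsEmpty "'a dterm" | NonEmpty "'a dterm" | LinConstr "'a cvar lin"

primrec constr_over :: "'a set \<Rightarrow> 'a constr \<Rightarrow> bool" where
  "constr_over \<Sigma> (IsEmpty x) = (set_dterm x \<subseteq> \<Sigma>)"
| "constr_over \<Sigma> (NonEmpty x) = (set_dterm x \<subseteq> \<Sigma>)"
| "constr_over \<Sigma> (LinConstr l) = (set_lin l \<subseteq> LetterVar ` \<Sigma> \<union> SetVar ` Pow \<Sigma>)"

primrec constr_count :: "'a set \<Rightarrow> 'a odtree \<Rightarrow> 'a cvar \<Rightarrow> nat" where
  "constr_count \<Sigma> t (LetterVar a) = card (label_nodes t a)"
| "constr_count \<Sigma> t (SetVar S) = card (Bracket \<Sigma> t S)"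

primrec constr_sat :: "'a set \<Rightarrow> 'a odtree \<Rightarrow> 'a constr \<Rightarrow> bool" where
  "constr_sat \<Sigma> t (IsEmpty x) = (dterm_val t x = {})"
| "constr_sat \<Sigma> t (NonEmpty x) = (dterm_val t x \<noteq> {})"
| "constr_sat \<Sigma> t (LinConstr l) = lin_sat (constr_count \<Sigma> t) l"


section \<open>Automata\<close>

record 'b nfa =
  nfa_states :: "nat set"
  nfa_trans :: "(nat \<times> 'b \<times> nat) set"
  nfa_init :: "nat set"
  nfa_final :: "nat set"

definition nfa_over :: "'b set \<Rightarrow> 'b nfa \<Rightarrow> bool" where
  "nfa_over B N \<longleftrightarrow> finite (nfa_states N) \<and>
     nfa_trans N \<subseteq> nfa_states N \<times> B \<times> nfa_states N \<and>
     nfa_init N \<subseteq> nfa_states N \<and> nfa_final N \<subseteq> nfa_states N"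

primrec nfa_reach :: "'b nfa \<Rightarrow> nat \<Rightarrow> 'b list \<Rightarrow> nat \<Rightarrow> bool" where
  "nfa_reach N p [] q = (p = q)"
| "nfa_reach N p (b # w) q = (\<exists>r. (p, b, r) \<in> nfa_trans N \<and> nfa_reach N r w q)"

definition nfa_lang :: "'b nfa \<Rightarrow> 'b list set" where
  "nfa_lang N = {w. \<exists>p \<in> nfa_init N. \<exists>q \<in> nfa_final N. nfa_reach N p w q}"

text \<open>Unranked tree automata: \<open>uta_trans A q a\<close> is an automaton for the regular language of the
  state sequences allowed at the children of an \<open>a\<close>-labelled node in state \<open>q\<close>.\<close>

record 'a uta =
  uta_alph :: "'a set"
  uta_states :: "nat set"
  uta_trans :: "nat \<Rightarrow> 'a \<Rightarrow> nat nfa"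
  uta_final :: "nat set"

definition wf_uta :: "'a uta \<Rightarrow> bool" where
  "wf_uta A \<longleftrightarrow> finite (uta_alph A) \<and> finite (uta_states A) \<and> uta_final A \<subseteq> uta_states A \<and>
     (\<forall>q \<in> uta_states A. \<forall>a \<in> uta_alph A. nfa_over (uta_states A) (uta_trans A q a))"

definition accepting_run :: "'a uta \<Rightarrow> 'a tree \<Rightarrow> (nat list \<Rightarrow> nat) \<Rightarrow> bool" where
  "accepting_run A t \<rho> \<longleftrightarrow>
     (\<forall>u \<in> nodes t. lab t u \<in> uta_alph A \<and> \<rho> u \<in> uta_states A \<and>
        map (\<lambda>i. \<rho> (u @ [i])) [0..<arity t u] \<in> nfa_lang (uta_trans A (\<rho> u) (lab t u))) \<and>
     \<rho> [] \<in> uta_final A"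

definition uta_accepts :: "'a uta \<Rightarrow> 'a tree \<Rightarrow> bool" where
  "uta_accepts A t = (\<exists>\<rho>. accepting_run A t \<rho>)"

record ('a, 'b) transducer =
  td_uta :: "'a uta"
  td_out_alph :: "'b set"
  td_out :: "(nat \<times> 'a \<times> 'b) set"

definition wf_transducer :: "('a, 'b) transducer \<Rightarrow> bool" where
  "wf_transducer T \<longleftrightarrow> wf_uta (td_uta T) \<and> finite (td_out_alph T) \<and>
     td_out T \<subseteq> uta_states (td_uta T) \<times> uta_alph (td_uta T) \<times> td_out_alph T"

definition is_output :: "('a, 'b) transducer \<Rightarrow> 'a tree \<Rightarrow> 'b tree \<Rightarrow> bool" where
  "is_output T t t' \<longleftrightarrow> nodes t' = nodes t \<and>
     (\<exists>\<rho>. accepting_run (td_uta T) t \<rho> \<and>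
        (\<forall>u \<in> nodes t. (\<rho> u, lab t u, lab t' u) \<in> td_out T))"

record ('a, 'b) wodta =
  wo_td :: "('a, 'b) transducer"
  wo_nfa :: "'b set nfa"
  wo_dist :: "'b set"

text \<open>The free variables of the formula are one for each letter and one for each nonempty set of
  letters of the output alphabet.\<close>

definition wf_ext_wodta :: "'a set \<Rightarrow> ('a, 'b) wodta \<Rightarrow> 'b cvar expresb \<Rightarrow> bool" where
  "wf_ext_wodta \<Sigma> S \<xi> \<longleftrightarrow> (let \<Gamma> = td_out_alph (wo_td S) in
     wf_transducer (wo_td S) \<and> uta_alph (td_uta (wo_td S)) = \<Sigma> \<and>
     nfa_over (Pow \<Gamma>) (wo_nfa S) \<and> wo_dist S \<subseteq> \<Gamma> \<and>
     free_vars \<xi> \<subseteq> LetterVar ` \<Gamma> \<union> SetVar ` (Pow \<Gamma> - {{}}))"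

primrec parikh_count :: "'b set \<Rightarrow> 'b odtree \<Rightarrow> 'b cvar \<Rightarrow> nat" where
  "parikh_count \<Gamma> t (LetterVar a) = card (label_nodes t a)"
| "parikh_count \<Gamma> t (SetVar S) = count_list (value_word \<Gamma> t) S"

definition ext_wodta_accepts :: "('a, 'b) wodta \<Rightarrow> 'b cvar expresb \<Rightarrow> 'a odtree \<Rightarrow> bool" where
  "ext_wodta_accepts S \<xi> t \<longleftrightarrow> (let \<Gamma> = td_out_alph (wo_td S) in
     \<exists>t' \<in> odtrees_over \<Gamma>.
       is_output (wo_td S) (Proj t) (Proj t') \<and> Data t' = Data t \<and>
       value_word \<Gamma> t' \<in> nfa_lang (wo_nfa S) \<and>
       (\<forall>a \<in> wo_dist S. inj_on (\<lambda>u. snd (lab t' u)) (label_nodes t' a)) \<and>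
       expresb_sat (parikh_count \<Gamma> t') \<xi>)"


section \<open>Computation model\<close>

text \<open>A deterministic first-order functional language over binary trees (S-expressions), with a
  cost semantics.  A program is a list of function bodies, \<open>Arg i\<close> is the \<open>i\<close>-th argument of the
  current call, and \<open>Call f es\<close> calls the \<open>f\<close>-th function.  Every value that is copied or built is
  charged its full size, every other step is charged 1; hence the cost bounds the size of all the
  values that occur, including the result, and it is polynomially related to Turing machine time.\<close>

datatype val = Nl | Pr val val

primrec vsize :: "val \<Rightarrow> nat" where
  "vsize Nl = 1"
| "vsize (Pr x y) = 1 + vsize x + vsize y"

primrec vfst :: "val \<Rightarrow> val" where
  "vfst Nl = Nl"
| "vfst (Pr x y) = x"

primrec vsnd :: "val \<Rightarrow> val" where
  "vsnd Nl = Nl"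
| "vsnd (Pr x y) = y"

definition vbool :: "bool \<Rightarrow> val" where
  "vbool b = (if b then Pr Nl Nl else Nl)"

datatype exp = Arg nat | NilE | PairE exp exp | FstE exp | SndE exp | EqE exp exp
  | IfE exp exp exp | Call nat "exp list"

type_synonym prog = "exp list"

inductive eval :: "prog \<Rightarrow> val list \<Rightarrow> exp \<Rightarrow> val \<Rightarrow> nat \<Rightarrow> bool"
  and evals :: "prog \<Rightarrow> val list \<Rightarrow> exp list \<Rightarrow> val list \<Rightarrow> nat \<Rightarrow> bool"
  for P :: prog where
  Arg: "i < length env \<Longrightarrow> eval P env (Arg i) (env ! i) (vsize (env ! i))"
| NilE: "eval P env NilE Nl 1"
| PairE: "eval P env e x m \<Longrightarrow> eval P env e' y n \<Longrightarrow>
    eval P env (PairE e e') (Pr x y) (m + n + vsize (Pr x y))"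
| FstE: "eval P env e x m \<Longrightarrow> eval P env (FstE e) (vfst x) (m + vsize (vfst x))"
| SndE: "eval P env e x m \<Longrightarrow> eval P env (SndE e) (vsnd x) (m + vsize (vsnd x))"
| EqE: "eval P env e x m \<Longrightarrow> eval P env e' y n \<Longrightarrow>
    eval P env (EqE e e') (vbool (x = y)) (m + n + vsize (vbool (x = y)))"
| IfTrue: "eval P env b x m \<Longrightarrow> x \<noteq> Nl \<Longrightarrow> eval P env e y n \<Longrightarrow>
    eval P env (IfE b e e') y (m + n + 1)"
| IfFalse: "eval P env b x m \<Longrightarrow> x = Nl \<Longrightarrow> eval P env e' y n \<Longrightarrow>
    eval P env (IfE b e e') y (m + n + 1)"
| Call: "f < length P \<Longrightarrow> evals P env es xs m \<Longrightarrow> eval P xs (P ! f) y n \<Longrightarrow>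
    eval P env (Call f es) y (m + n + 1)"
| Empty: "evals P env [] [] 1"
| More: "eval P env e x m \<Longrightarrow> evals P env es xs n \<Longrightarrow> evals P env (e # es) (x # xs) (m + n)"

definition computes :: "prog \<Rightarrow> val \<Rightarrow> val \<Rightarrow> nat \<Rightarrow> bool" where
  "computes P inp out time = eval P [inp] (Call 0 [Arg 0]) out time"

inductive_cases eval_cases:
  "eval P env (Arg i) y n" "eval P env NilE y n" "eval P env (PairE e e') y n"
  "eval P env (FstE e) y n" "eval P env (SndE e) y n" "eval P env (EqE e e') y n"
  "eval P env (IfE b e e') y n" "eval P env (Call f es) y n"

inductive_cases evals_cases:
  "evals P env [] ys n" "evals P env (e # es) ys n"

lemma eval_deterministic:
  "eval P env e x m \<Longrightarrow> eval P env e x' m' \<Longrightarrow> x = x' \<and> m = m'"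
  "evals P env es xs n \<Longrightarrow> evals P env es xs' n' \<Longrightarrow> xs = xs' \<and> n = n'"
proof (induction arbitrary: x' m' and xs' n' rule: eval_evals.inducts)
  case (EqE env e x m e' y n)
  show ?case by (rule eval_cases(6)[OF EqE.prems]) (drule EqE.IH(2), drule EqE.IH(4), simp)
next
  case (Call f env es xs m y n)
  show ?case by (rule eval_cases(8)[OF Call.prems]) (drule Call.IH(3), clarify, drule Call.IH(5), simp)
next
  case (IfTrue env b x m e y n e')
  show ?case by (rule eval_cases(7)[OF IfTrue.prems]) 
      (drule IfTrue.IH(2), (drule IfTrue.IH(4))?, use IfTrue.hyps in simp)+
next
  case (IfFalse env b x m e' y n e)
  show ?case by (rule eval_cases(7)[OF IfFalse.prems]) 
      (drule IfFalse.IH(2), (drule IfFalse.IH(4))?, use IfFalse.hyps in simp)+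
next
  case (Arg i env)
  then show ?case by (auto elim: eval_cases)
next
  case (NilE env)
  then show ?case by (auto elim: eval_cases)
next
  case (PairE env e x m e' y n)
  show ?case by (rule eval_cases(3)[OF PairE.prems]) (drule PairE.IH(2), drule PairE.IH(4), simp)
next
  case (FstE env e x m)
  show ?case by (rule eval_cases(4)[OF FstE.prems]) (drule FstE.IH(2), simp)
next
  case (SndE env e x m)
  show ?case by (rule eval_cases(5)[OF SndE.prems]) (drule SndE.IH(2), simp)
next
  case (Empty env)
  then show ?case by (auto elim: evals_cases)
next
  case (More env e x m es xs n)
  show ?case by (rule evals_cases(2)[OF More.prems]) (drule More.IH(2), drule More.IH(4), simp)
qed

lemma vsize_le_time:
  "eval P env e x m \<Longrightarrow> vsize x \<le> m"
  "evals P env es xs n \<Longrightarrow> sum_list (map vsize xs) \<le> n"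
  by (induction rule: eval_evals.inducts) auto


section \<open>Codes\<close>

text \<open>Numbers are coded in binary.  A finite set is coded by a list of codes of its elements, in any
  order, so that an object has in general several codes.\<close>

fun code_nat :: "nat \<Rightarrow> val" where
  "code_nat n = (if n = 0 then Nl else Pr (vbool (odd n)) (code_nat (n div 2)))"

declare code_nat.simps [simp del]

primrec code_list :: "val list \<Rightarrow> val" where
  "code_list [] = Nl"
| "code_list (d # ds) = Pr d (code_list ds)"

definition tagged :: "nat \<Rightarrow> val set \<Rightarrow> val set" where
  "tagged n D = Pr (code_nat n) ` D"

definition pairs :: "val set \<Rightarrow> val set \<Rightarrow> val set" where
  "pairs D E = {Pr d e | d e. d \<in> D \<and> e \<in> E}"

definition codes_prod :: "('x \<Rightarrow> val set) \<Rightarrow> ('y \<Rightarrow> val set) \<Rightarrow> 'x \<times> 'y \<Rightarrow> val set" where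
  "codes_prod c c' p = pairs (c (fst p)) (c' (snd p))"

definition codes_list :: "('x \<Rightarrow> val set) \<Rightarrow> 'x list \<Rightarrow> val set" where
  "codes_list c xs = {code_list ds | ds. list_all2 (\<lambda>d x. d \<in> c x) ds xs}"

definition codes_set :: "('x \<Rightarrow> val set) \<Rightarrow> 'x set \<Rightarrow> val set" where
  "codes_set c X = (\<Union>xs \<in> {xs. set xs = X}. codes_list c xs)"

definition codes_nat :: "nat \<Rightarrow> val set" where
  "codes_nat n = {code_nat n}"

definition codes_int :: "int \<Rightarrow> val set" where
  "codes_int k = {Pr (vbool (k < 0)) (code_nat (nat \<bar>k\<bar>))}"

primrec codes_cmp :: "cmp \<Rightarrow> val set" where
  "codes_cmp LE = {code_nat 0}"
| "codes_cmp LT = {code_nat 1}"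
| "codes_cmp EQ = {code_nat 2}"
| "codes_cmp GE = {code_nat 3}"
| "codes_cmp GT = {code_nat 4}"

fun codes_lin :: "('v \<Rightarrow> val set) \<Rightarrow> 'v lin \<Rightarrow> val set" where
  "codes_lin c (Lin ts r k) =
     pairs (codes_list (codes_prod codes_int c) ts) (pairs (codes_cmp r) (codes_int k))"

primrec codes_cvar :: "nat cvar \<Rightarrow> val set" where
  "codes_cvar (LetterVar a) = tagged 0 (codes_nat a)"
| "codes_cvar (SetVar S) = tagged 1 (codes_set codes_nat S)"

primrec codes_dterm :: "nat dterm \<Rightarrow> val set" where
  "codes_dterm (V a) = tagged 0 (codes_nat a)"
| "codes_dterm (Cup x y) = tagged 1 (pairs (codes_dterm x) (codes_dterm y))"
| "codes_dterm (Cap x y) = tagged 2 (pairs (codes_dterm x) (codes_dterm y))"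
| "codes_dterm (Compl x) = tagged 3 (codes_dterm x)"

primrec codes_constr :: "nat constr \<Rightarrow> val set" where
  "codes_constr (IsEmpty x) = tagged 0 (codes_dterm x)"
| "codes_constr (NonEmpty x) = tagged 1 (codes_dterm x)"
| "codes_constr (LinConstr l) = tagged 2 (codes_lin codes_cvar l)"

primrec codes_sum :: "('x \<Rightarrow> val set) \<Rightarrow> ('y \<Rightarrow> val set) \<Rightarrow> 'x + 'y \<Rightarrow> val set" where
  "codes_sum c c' (Inl x) = tagged 0 (c x)"
| "codes_sum c c' (Inr y) = tagged 1 (c' y)"

primrec codes_qfree :: "('v \<Rightarrow> val set) \<Rightarrow> 'v qfree \<Rightarrow> val set" where
  "codes_qfree c (Atom l) = tagged 0 (codes_lin c l)"
| "codes_qfree c (Neg f) = tagged 1 (codes_qfree c f)"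
| "codes_qfree c (Conj f g) = tagged 2 (pairs (codes_qfree c f) (codes_qfree c g))"
| "codes_qfree c (Disj f g) = tagged 3 (pairs (codes_qfree c f) (codes_qfree c g))"

definition codes_expresb :: "nat cvar expresb \<Rightarrow> val set" where
  "codes_expresb \<xi> = codes_qfree (codes_sum codes_cvar codes_nat) (matrix \<xi>)"

definition codes_nfa :: "('b \<Rightarrow> val set) \<Rightarrow> 'b nfa \<Rightarrow> val set" where
  "codes_nfa c N =
     pairs (codes_set codes_nat (nfa_states N))
    (pairs (codes_set (codes_prod codes_nat (codes_prod c codes_nat)) (nfa_trans N))
    (pairs (codes_set codes_nat (nfa_init N)) (codes_set codes_nat (nfa_final N))))"

text \<open>The transition function is coded by its table on \<open>uta_states A \<times> uta_alph A\<close>.\<close>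

definition codes_uta :: "nat uta \<Rightarrow> val set" where
  "codes_uta A =
     pairs (codes_set codes_nat (uta_alph A))
    (pairs (codes_set codes_nat (uta_states A))
    (pairs (codes_set (codes_prod codes_nat (codes_prod codes_nat (codes_nfa codes_nat)))
              {(q, a, uta_trans A q a) | q a. q \<in> uta_states A \<and> a \<in> uta_alph A})
           (codes_set codes_nat (uta_final A))))"

definition codes_transducer :: "(nat, nat) transducer \<Rightarrow> val set" where
  "codes_transducer T =
     pairs (codes_uta (td_uta T))
    (pairs (codes_set codes_nat (td_out_alph T))
           (codes_set (codes_prod codes_nat (codes_prod codes_nat codes_nat)) (td_out T)))"

definition codes_wodta :: "(nat, nat) wodta \<Rightarrow> val set" where
  "codes_wodta S =
     pairs (codes_transducer (wo_td S))
    (pairs (codes_nfa (codes_set codes_nat) (wo_nfa S)) (codes_set codes_nat (wo_dist S)))"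

definition codes_input :: "nat uta \<Rightarrow> nat constr set \<Rightarrow> val set" where
  "codes_input A C = pairs (codes_uta A) (codes_set codes_constr C)"

definition codes_output :: "(nat, nat) wodta \<Rightarrow> nat cvar expresb \<Rightarrow> val set" where
  "codes_output S \<xi> = pairs (codes_wodta S) (codes_expresb \<xi>)"

text \<open>Every admissible input has a code.\<close>

lemma codes_list_nonempty:
  assumes "\<forall>x \<in> set xs. c x \<noteq> {}"
  shows "codes_list c xs \<noteq> {}"
proof -
  have "list_all2 (\<lambda>d x. d \<in> c x) (map (\<lambda>x. SOME d. d \<in> c x) xs) xs"
    using assms by (auto simp: list_all2_conv_all_nth intro!: some_in_eq[THEN iffD2])
  then show ?thesis by (auto simp: codes_list_def)
qed

lemma codes_set_nonempty: "finite X \<Longrightarrow> \<forall>x \<in> X. c x \<noteq> {} \<Longrightarrow> codes_set c X \<noteq> {}"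
  using finite_list[of X] codes_list_nonempty[of _ c] by (fastforce simp: codes_set_def)

lemma pairs_nonempty: "D \<noteq> {} \<Longrightarrow> E \<noteq> {} \<Longrightarrow> pairs D E \<noteq> {}"
  and pairs_empty_iff: "pairs D E = {} \<longleftrightarrow> D = {} \<or> E = {}"
  by (auto simp: pairs_def)

lemma codes_input_nonempty:
  assumes A: "wf_uta A" and C: "finite C" "\<forall>\<gamma> \<in> C. constr_over (uta_alph A) \<gamma>"
  shows "codes_input A C \<noteq> {}"
proof -
  have fin: "finite (uta_alph A)" "finite (uta_states A)" "finite (uta_final A)"
    using A finite_subset by (auto simp: wf_uta_def)
  have nat: "codes_nat n \<noteq> {}" for n by (simp add: codes_nat_def)
  have nats: "codes_set codes_nat X \<noteq> {}" if "finite X" for X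
    using that nat by (intro codes_set_nonempty) auto
  have nfa: "codes_nfa codes_nat N \<noteq> {}" if "nfa_over B N" "finite B" for B N
  proof -
    have "finite (nfa_states N \<times> B \<times> nfa_states N)" using that by (auto simp: nfa_over_def)
    then have "finite (nfa_states N)" "finite (nfa_init N)" "finite (nfa_final N)" "finite (nfa_trans N)"
      using that by (auto simp: nfa_over_def intro: finite_subset)
    then show ?thesis unfolding codes_nfa_def
      by (intro pairs_nonempty nats codes_set_nonempty) (auto simp: codes_prod_def nat pairs_nonempty)
  qed
  let ?tab = "{(q, a, uta_trans A q a) | q a. q \<in> uta_states A \<and> a \<in> uta_alph A}"
  have "?tab = (\<lambda>(q, a). (q, a, uta_trans A q a)) ` (uta_states A \<times> uta_alph A)" by auto
  then have "finite ?tab" using fin by simp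
  moreover have "\<forall>x \<in> ?tab. codes_prod codes_nat (codes_prod codes_nat (codes_nfa codes_nat)) x \<noteq> {}"
    using A nfa fin by (fastforce simp: codes_prod_def wf_uta_def pairs_empty_iff nat)
  ultimately have uta: "codes_uta A \<noteq> {}"
    unfolding codes_uta_def by (intro pairs_nonempty nats fin codes_set_nonempty)
  have dt: "codes_dterm x \<noteq> {}" for x
    by (induction x) (auto simp: tagged_def pairs_nonempty nat)
  have "codes_constr \<gamma> \<noteq> {}" if co: "constr_over (uta_alph A) \<gamma>" for \<gamma>
  proof (cases \<gamma>)
    case (LinConstr l)
    obtain ts r k where l: "l = Lin ts r k" by (cases l)
    have "codes_cvar v \<noteq> {}" if "v \<in> snd ` set ts" for v
    proof (cases v)
      case (SetVar S)
      have "v \<in> LetterVar ` uta_alph A \<union> SetVar ` Pow (uta_alph A)"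
        using that co LinConstr l by (force simp: prod_set_simps)
      then have "finite S" using SetVar fin by (auto intro: finite_subset)
      then show ?thesis using SetVar nats by (simp add: tagged_def)
    qed (simp add: tagged_def nat)
    then have "codes_list (codes_prod codes_int codes_cvar) ts \<noteq> {}"
      by (intro codes_list_nonempty) (force simp: codes_prod_def codes_int_def pairs_empty_iff)
    moreover have "codes_cmp r \<noteq> {}" by (cases r) auto
    ultimately show ?thesis
      using LinConstr l by (simp add: tagged_def pairs_nonempty codes_int_def)
  qed (auto simp: tagged_def dt)
  then show ?thesis
    unfolding codes_input_def using C by (intro pairs_nonempty uta codes_set_nonempty) auto
qed

end

theory Submission
  imports Defs
begin

text \<open>
  Let the transducer be the identity on \<open>A\<close> and let the string automaton accept every word, so that
  the output tree is \<open>t\<close> itself; all the constraints are then put into the formula. Since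
  \<open>[S]\<^sub>t\<close> is counted by \<open>y\<^sub>S\<close>, the constraint \<open>\<tau> = \<emptyset>\<close> says that the sum of the \<open>y\<^sub>S\<close> over the nonempty
  \<open>S\<close> that satisfy \<open>\<tau>\<close> as a propositional formula is 0, and \<open>\<tau> \<noteq> \<emptyset>\<close> that this sum is at least 1.
  In a linear constraint the variable \<open>z\<^sub>\<emptyset>\<close>, which is always 0, has no counterpart and is dropped.
  No existential quantifier is needed, and only the enumeration of all subsets of the alphabet is
  exponential. A letter that is repeated in the code of the alphabet makes some \<open>y\<^sub>S\<close> occur several
  times in a sum, which does not affect whether the sum is 0.
\<close>

section \<open>Programs and their running times\<close>

text \<open>Inversion of the cost semantics as equivalences, so that the simplifier can run an
  expression symbolically and collect its cost.\<close>

lemma eval_simps: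
  "eval P env (Arg i) y n \<longleftrightarrow> i < length env \<and> y = env ! i \<and> n = vsize (env ! i)"
  "eval P env NilE y n \<longleftrightarrow> y = Nl \<and> n = 1"
  "eval P env (PairE e e') y n \<longleftrightarrow> (\<exists>x m x' m'. eval P env e x m \<and> eval P env e' x' m' \<and>
     y = Pr x x' \<and> n = m + m' + vsize (Pr x x'))"
  "eval P env (FstE e) y n \<longleftrightarrow> (\<exists>x m. eval P env e x m \<and> y = vfst x \<and> n = m + vsize (vfst x))"
  "eval P env (SndE e) y n \<longleftrightarrow> (\<exists>x m. eval P env e x m \<and> y = vsnd x \<and> n = m + vsize (vsnd x))"
  "eval P env (EqE e e') y n \<longleftrightarrow> (\<exists>x m x' m'. eval P env e x m \<and> eval P env e' x' m' \<and>
     y = vbool (x = x') \<and> n = m + m' + vsize (vbool (x = x')))"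
  "eval P env (IfE b e e') y n \<longleftrightarrow> (\<exists>x m k. eval P env b x m \<and>
     (if x = Nl then eval P env e' y k else eval P env e y k) \<and> n = m + k + 1)"
  "eval P env (Call f es) y n \<longleftrightarrow> f < length P \<and> (\<exists>xs m k. evals P env es xs m \<and>
     eval P xs (P ! f) y k \<and> n = m + k + 1)"
          apply (simp add: eval.simps[of _ _ "Arg i"], blast)
         apply (simp add: eval.simps[of _ _ NilE])
        apply (simp add: eval.simps[of _ _ "PairE e e'"], blast)
       apply (simp add: eval.simps[of _ _ "FstE e"], blast)
      apply (simp add: eval.simps[of _ _ "SndE e"], blast)
     apply (simp add: eval.simps[of _ _ "EqE e e'"], blast)
    apply (simp add: eval.simps[of _ _ "IfE b e e'"], blast)
   apply (simp add: eval.simps[of _ _ "Call f es"], blast)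
  done

lemma evals_simps:
  "evals P env [] ys n \<longleftrightarrow> ys = [] \<and> n = 1"
  "evals P env (e # es) ys n \<longleftrightarrow> (\<exists>x m xs k. eval P env e x m \<and> evals P env es xs k \<and>
     ys = x # xs \<and> n = m + k)"
   apply (simp add: evals.simps[of _ _ "[]"])
  apply (simp add: evals.simps[of _ _ "e # es"], blast)
  done

text \<open>By determinism a single known evaluation becomes a rewrite rule for value and cost.
  Instances of it resolve the recursive and auxiliary calls met in a symbolic run.\<close>

lemma eval_iff: "eval P env e x m \<Longrightarrow> eval P env e y n \<longleftrightarrow> y = x \<and> n = m"
  using eval_deterministic(1) by blast

lemma vsize_pos [simp]: "0 < vsize v" "Suc 0 \<le> vsize v"
  by (cases v; simp)+

lemma vbool_eq_Nl [simp]: "vbool b = Nl \<longleftrightarrow> \<not> b"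
  by (simp add: vbool_def)

section \<open>Binary codes of numbers\<close>

lemma code_nat_0 [simp]: "code_nat 0 = Nl"
  by (simp add: code_nat.simps)

lemma code_nat_pos: "0 < n \<Longrightarrow> code_nat n = Pr (vbool (odd n)) (code_nat (n div 2))"
  by (subst code_nat.simps) simp

text \<open>The lowest digit and the code of the half determine the number, whence the induction by
  halving. Injectivity lets the program compare letters by comparing their codes.\<close>

lemma code_nat_inject [simp]: "code_nat m = code_nat n \<longleftrightarrow> m = n"
proof (induction m arbitrary: n rule: less_induct)
  case (less m)
  show ?case
  proof (cases "m = 0 \<or> n = 0")
    case True
    then show ?thesis by (cases "m = 0"; cases "n = 0"; simp add: code_nat_pos)
  next
    case False
    then have "code_nat m = code_nat n \<longleftrightarrow> odd m = odd n \<and> m div 2 = n div 2"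
      using less[of "m div 2"] by (auto simp: code_nat_pos vbool_def split: if_splits)
    also have "\<dots> \<longleftrightarrow> m = n" by presburger
    finally show ?thesis .
  qed
qed

lemma code_nat_numerals [simp]:
  "code_nat (Suc 0) = Pr (Pr Nl Nl) Nl"
  "code_nat 1 = Pr (Pr Nl Nl) Nl"
  "code_nat 2 = Pr Nl (Pr (Pr Nl Nl) Nl)"
  "code_nat 3 = Pr (Pr Nl Nl) (Pr (Pr Nl Nl) Nl)"
  by (simp_all add: code_nat_pos vbool_def)

text \<open>Digits come lowest first, so these expressions evaluate to the codes of 1, 2 and 3. They
  serve as constructor tags and as the constants of the atoms.\<close>

abbreviation "OneE \<equiv> PairE (PairE NilE NilE) NilE"
abbreviation "TwoE \<equiv> PairE NilE OneE"
abbreviation "ThreeE \<equiv> PairE (PairE NilE NilE) OneE"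

text \<open>
  The functions of the program, in order: 0 and 1 the main function, 2 and 3 the output relation,
  4 and 5 the list of all subsets of the alphabet, 6 the transitions of the string automaton,
  7 membership in a set, 8 satisfaction of a data term by a set of letters, 9 the sum of the
  \<open>y\<^sub>S\<close> for a data term, 10 the terms of a linear constraint, 11 the atom for a constraint, 12 the
  conjunction of these atoms.
\<close>

definition prog :: prog where
  "prog = [
    Call 1 [FstE (Arg 0), SndE (Arg 0), Call 5 [FstE (FstE (Arg 0))]],
    PairE
      (PairE
        (PairE (Arg 0) (PairE (FstE (Arg 0)) (Call 3 [FstE (SndE (Arg 0)), FstE (Arg 0)])))
        (PairE (PairE (PairE NilE NilE)
           (PairE (Call 6 [Arg 2]) (PairE (PairE NilE NilE) (PairE NilE NilE)))) NilE))
      (Call 12 [Arg 1, Arg 2]),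
    IfE (Arg 1)
      (PairE (PairE (Arg 0) (PairE (FstE (Arg 1)) (FstE (Arg 1))))
         (Call 2 [Arg 0, SndE (Arg 1), Arg 2]))
      (Arg 2),
    IfE (Arg 0)
      (Call 2 [FstE (Arg 0), Arg 1, Call 3 [SndE (Arg 0), Arg 1]])
      NilE,
    IfE (Arg 1)
      (PairE (PairE (Arg 0) (FstE (Arg 1))) (Call 4 [Arg 0, SndE (Arg 1), Arg 2]))
      (Arg 2),
    IfE (Arg 0)
      (Call 4 [FstE (Arg 0), Call 5 [SndE (Arg 0)], Call 5 [SndE (Arg 0)]])
      (PairE NilE NilE),
    IfE (Arg 0)
      (PairE (PairE NilE (PairE (FstE (Arg 0)) NilE)) (Call 6 [SndE (Arg 0)]))
      NilE,
    IfE (Arg 1)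
      (IfE (EqE (Arg 0) (FstE (Arg 1))) (PairE NilE NilE) (Call 7 [Arg 0, SndE (Arg 1)]))
      NilE,
    IfE (EqE (FstE (Arg 0)) NilE)
      (Call 7 [SndE (Arg 0), Arg 1])
    (IfE (EqE (FstE (Arg 0)) OneE)
      (IfE (Call 8 [FstE (SndE (Arg 0)), Arg 1])
        (PairE NilE NilE)
        (Call 8 [SndE (SndE (Arg 0)), Arg 1]))
    (IfE (EqE (FstE (Arg 0)) TwoE)
      (IfE (Call 8 [FstE (SndE (Arg 0)), Arg 1])
        (Call 8 [SndE (SndE (Arg 0)), Arg 1])
        NilE)
      (EqE (Call 8 [SndE (Arg 0), Arg 1]) NilE))),
    IfE (Arg 1)
      (IfE (IfE (FstE (Arg 1)) (Call 8 [Arg 0, FstE (Arg 1)]) NilE)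
        (PairE (PairE (PairE NilE OneE) (PairE NilE (PairE OneE (FstE (Arg 1)))))
          (Call 9 [Arg 0, SndE (Arg 1)]))
        (Call 9 [Arg 0, SndE (Arg 1)]))
      NilE,
    IfE (Arg 0)
      (IfE (EqE (SndE (FstE (Arg 0))) (PairE OneE NilE))
        (Call 10 [SndE (Arg 0)])
        (PairE (PairE (FstE (FstE (Arg 0))) (PairE NilE (SndE (FstE (Arg 0)))))
          (Call 10 [SndE (Arg 0)])))
      NilE,
    IfE (EqE (FstE (Arg 0)) NilE)
      (PairE NilE (PairE (Call 9 [SndE (Arg 0), Arg 1]) (PairE TwoE (PairE NilE NilE))))
    (IfE (EqE (FstE (Arg 0)) OneE)
      (PairE NilE (PairE (Call 9 [SndE (Arg 0), Arg 1]) (PairE ThreeE (PairE NilE OneE))))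
      (PairE NilE (PairE (Call 10 [FstE (SndE (Arg 0))]) (SndE (SndE (Arg 0)))))),
    IfE (Arg 0)
      (PairE TwoE (PairE (Call 11 [FstE (Arg 0), Arg 1]) (Call 12 [SndE (Arg 0), Arg 1])))
      (PairE NilE (PairE NilE (PairE TwoE (PairE NilE NilE))))]"

lemma length_prog [simp]: "length prog = 13"
  by (simp add: prog_def)

section \<open>Sizes of coded lists\<close>

lemma vsize_code_list: "vsize (code_list ds) = Suc (\<Sum>d\<leftarrow>ds. Suc (vsize d))"
  by (induction ds) auto

text \<open>The functions build their lists from the back, so every recursive result is a suffix of
  the final one and inherits its size bound.\<close>

lemma vsize_code_list_append: "vsize (code_list es) \<le> vsize (code_list (ds @ es))"
  by (simp add: vsize_code_list)

lemma vsize_member: "d \<in> set ds \<Longrightarrow> vsize d < vsize (code_list ds)"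
  by (induction ds) auto

lemma length_less_vsize: "length ds < vsize (code_list ds)"
  by (induction ds) auto

lemma vsize_code_list_le:
  assumes "\<And>d. d \<in> set ds \<Longrightarrow> vsize d \<le> M"
  shows "vsize (code_list ds) \<le> Suc (length ds * Suc M)"
  using assms by (induction ds) fastforce+

text \<open>
  Running times are bounded by a number of steps times a bound \<open>W\<close> on the sizes of all the values that
  occur. As a sub-result is never larger than the result, it suffices to bound the arguments and
  the result by \<open>W\<close>.
\<close>

lemma eval_row:
  assumes "vsize q \<le> W" "vsize (code_list as) \<le> W"
    and "vsize (code_list (map (\<lambda>a. Pr q (Pr a a)) as @ rest)) \<le> W"
  shows "\<exists>m \<le> 40 * Suc (length as) * W. eval prog [q, code_list as, code_list rest] (prog ! 2)
    (code_list (map (\<lambda>a. Pr q (Pr a a)) as @ rest)) m"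
  using assms
proof (induction as)
  case Nil
  then show ?case
    using vsize_pos(1)[of q] by (simp add: prog_def eval_simps del: vsize_pos)
next
  case (Cons a as)
  then obtain m where "m \<le> 40 * Suc (length as) * W"
    and "eval prog [q, code_list as, code_list rest] (prog ! 2)
    (code_list (map (\<lambda>a. Pr q (Pr a a)) as @ rest)) m" by auto
  note m = this(1) and [simp] = eval_iff[OF this(2)]
  \<comment> \<open>Only the \<open>prog\<close> that supplies the body is unfolded. The calls in
    the body thus keep the form \<open>prog ! i\<close> and match the evaluation rules already
    declared as rewrite rules.\<close>
  show ?case
    using m Cons.prems vsize_code_list_append[of rest "map (\<lambda>a. Pr q (Pr a a)) as"]
      vsize_pos(2)[of a]
    by (subst (2) prog_def) (simp add: eval_simps evals_simps algebra_simps del: vsize_pos)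
qed

text \<open>The output relation of the identity transducer: each state passes each letter on
  unchanged. One row is written per state, in front of the rows of the remaining states.\<close>

lemma eval_prod:
  assumes "vsize (code_list qs) \<le> W" "vsize (code_list as) \<le> W"
    and "vsize (code_list (concat (map (\<lambda>q. map (\<lambda>a. Pr q (Pr a a)) as) qs))) \<le> W"
  shows "\<exists>m \<le> 100 * Suc (length as) * Suc (length qs) * W. eval prog [code_list qs, code_list as] (prog ! 3)
    (code_list (concat (map (\<lambda>q. map (\<lambda>a. Pr q (Pr a a)) as) qs))) m"
  using assms
proof (induction qs)
  case Nil
  then show ?case
    by (simp add: prog_def eval_simps algebra_simps trans_le_add1)
next
  case (Cons q qs)
  let ?rest = "concat (map (\<lambda>q. map (\<lambda>a. Pr q (Pr a a)) as) qs)"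
  have *: "vsize (code_list ?rest) \<le> W"
    using Cons.prems vsize_code_list_append[of ?rest] by (auto intro: order_trans)
  then obtain m where "m \<le> 100 * Suc (length as) * Suc (length qs) * W"
    and "eval prog [code_list qs, code_list as] (prog ! 3) (code_list ?rest) m"
    using Cons by auto
  note m = this(1) and [simp] = eval_iff[OF this(2)]
  obtain k where "k \<le> 40 * Suc (length as) * W"
    and "eval prog [q, code_list as, code_list ?rest] (prog ! 2)
    (code_list (map (\<lambda>a. Pr q (Pr a a)) as @ ?rest)) k"
    using eval_row[of q W as ?rest] Cons.prems by auto
  note k = this(1) and [simp] = eval_iff[OF this(2)]
  show ?case
    using m k Cons.prems * vsize_pos(2)[of q]
    by (subst (2) prog_def) (simp add: eval_simps evals_simps algebra_simps del: vsize_pos)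
qed

text \<open>One step in the enumeration of subsets: those containing \<open>a\<close> are put in
  front of those without it.\<close>

lemma eval_consall:
  assumes "vsize a \<le> W" "vsize (code_list ss) \<le> W"
    and "vsize (code_list (map (Pr a) ss @ rest)) \<le> W"
  shows "\<exists>m \<le> 40 * Suc (length ss) * W. eval prog [a, code_list ss, code_list rest] (prog ! 4)
    (code_list (map (Pr a) ss @ rest)) m"
  using assms
proof (induction ss)
  case Nil
  then show ?case
    using vsize_pos(1)[of a] by (simp add: prog_def eval_simps del: vsize_pos)
next
  case (Cons s ss)
  then obtain m where "m \<le> 40 * Suc (length ss) * W"
    and "eval prog [a, code_list ss, code_list rest] (prog ! 4)
    (code_list (map (Pr a) ss @ rest)) m" by auto
  note m = this(1) and [simp] = eval_iff[OF this(2)]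
  show ?case
    using m Cons.prems vsize_code_list_append[of rest "map (Pr a) ss"]
      vsize_pos(2)[of a]
    by (subst (2) prog_def) (simp add: eval_simps evals_simps algebra_simps del: vsize_pos)
qed

text \<open>The body calls itself twice on the tail, so the cost T satisfies T(n+1) \<le> 2 T(n) +
  O(2^n W). The bound by 4^n absorbs both the doubling and the length of the list of
  subsets.\<close>

lemma eval_subs:
  assumes "vsize (code_list as) \<le> W" "vsize (code_list (map code_list (subseqs as))) \<le> W"
  shows "\<exists>m \<le> 100 * 4 ^ length as * W. eval prog [code_list as] (prog ! 5)
    (code_list (map code_list (subseqs as))) m"
  using assms
proof (induction as)
  case Nil
  then show ?case
    by (simp add: prog_def eval_simps)
next
  case (Cons a as)
  let ?ss = "map code_list (subseqs as)"
  have eq: "map code_list (subseqs (a # as)) = map (Pr a) ?ss @ ?ss"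
    by (simp add: Let_def)
  have *: "vsize (code_list ?ss) \<le> W"
    using Cons.prems vsize_code_list_append[of ?ss] eq by (metis order_trans)
  then obtain m where "m \<le> 100 * 4 ^ length as * W"
    and "eval prog [code_list as] (prog ! 5) (code_list ?ss) m"
    using Cons by auto
  note m = this(1) and [simp] = eval_iff[OF this(2)]
  obtain k where "k \<le> 40 * Suc (length ?ss) * W"
    and "eval prog [a, code_list ?ss, code_list ?ss] (prog ! 4) (code_list (map (Pr a) ?ss @ ?ss)) k"
    using eval_consall[of a W ?ss ?ss] Cons.prems * unfolding eq by auto
  note k = this(1) and [simp] = eval_iff[OF this(2)]
  have "Suc (2 ^ length as) \<le> 2 * 4 ^ length as"
    using power_mono[of "2::nat" 4 "length as"] one_le_power[of "2::nat" "length as"] by linarith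
  then have "40 * Suc (length ?ss) * W \<le> 40 * (2 * 4 ^ length as) * W"
    by (intro mult_right_mono mult_left_mono) (simp_all add: length_subseqs)
  with k have k: "k \<le> 40 * (2 * 4 ^ length as) * W"
    by linarith
  \<comment> \<open>In units of \<open>X\<close> the two recursive calls cost at most 200 and the
    prefixing at most 80. What remains of the target 400 pays for copying.\<close>
  define X where "X = 4 ^ length as * W"
  have "W \<le> X"
    by (simp add: X_def)
  moreover have "m \<le> 100 * X" "k \<le> 80 * X"
    using m k by (simp_all add: X_def)
  ultimately have "\<exists>m \<le> 400 * X. eval prog [code_list (a # as)] (prog ! 5)
    (code_list (map (Pr a) ?ss @ ?ss)) m"
    using Cons.prems(1) * vsize_pos(2)[of a]
    by (subst (2) prog_def) (simp add: eval_simps evals_simps del: vsize_pos)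
  then show ?case
    unfolding eq by (simp add: X_def mult.assoc)
qed

text \<open>Each subset of the alphabet labels a loop at state 0, whose code is
  \<open>Nl\<close>.\<close>

lemma eval_trans:
  assumes "vsize (code_list (map (\<lambda>s. Pr Nl (Pr s Nl)) ss)) \<le> W"
  shows "\<exists>m \<le> 40 * Suc (length ss) * W. eval prog [code_list ss] (prog ! 6)
    (code_list (map (\<lambda>s. Pr Nl (Pr s Nl)) ss)) m"
  using assms
proof (induction ss)
  case Nil
  then show ?case
    by (simp add: prog_def eval_simps)
next
  case (Cons s ss)
  then obtain m where "m \<le> 40 * Suc (length ss) * W"
    and "eval prog [code_list ss] (prog ! 6)
    (code_list (map (\<lambda>s. Pr Nl (Pr s Nl)) ss)) m" by auto
  note m = this(1) and [simp] = eval_iff[OF this(2)]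
  have "vsize (code_list ss) \<le> vsize (code_list (map (\<lambda>s. Pr Nl (Pr s Nl)) ss))"
    by (induction ss) auto
  then show ?case
    using m Cons.prems
      vsize_pos(2)[of s]
    by (subst (2) prog_def) (simp add: eval_simps evals_simps algebra_simps del: vsize_pos)
qed

section \<open>Satisfaction of data terms by sets of letters\<close>

lemma eval_mem:
  assumes "vsize (code_nat a) \<le> W" "vsize (code_list (map code_nat s)) \<le> W" "3 \<le> W"
  shows "\<exists>m \<le> 40 * Suc (length s) * W. eval prog [code_nat a, code_list (map code_nat s)] (prog ! 7)
    (vbool (a \<in> set s)) m"
  using assms
proof (induction s)
  case Nil
  then show ?case
    by (simp add: prog_def eval_simps vbool_def)
next
  case (Cons b s)
  then obtain m where "m \<le> 40 * Suc (length s) * W"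
    and "eval prog [code_nat a, code_list (map code_nat s)] (prog ! 7)
    (vbool (a \<in> set s)) m" by auto
  note m = this(1) and [simp] = eval_iff[OF this(2)]
  show ?case
    using m Cons.prems
      vsize_pos(2)[of "code_nat b"]
    by (subst (2) prog_def) (simp add: eval_simps evals_simps algebra_simps vbool_def del: vsize_pos)
qed

text \<open>Whether a data value belongs to a data term depends only on the set \<open>S\<close> of
  letters that carry it. The term is read as a propositional formula whose atoms are
  letters.\<close>

primrec dterm_sat :: "'a set \<Rightarrow> 'a dterm \<Rightarrow> bool" where
  "dterm_sat S (V a) = (a \<in> S)"
| "dterm_sat S (Cup x y) = (dterm_sat S x \<or> dterm_sat S y)"
| "dterm_sat S (Cap x y) = (dterm_sat S x \<and> dterm_sat S y)"
| "dterm_sat S (Compl x) = (\<not> dterm_sat S x)"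

text \<open>Every node of the term is evaluated at most once and a leaf costs one scan of
  \<open>s\<close>, which explains the factors \<open>vsize d\<close> and
  \<open>Suc (length s)\<close>.\<close>

lemma eval_sat:
  assumes "d \<in> codes_dterm x" "vsize d \<le> W" "vsize (code_list (map code_nat s)) \<le> W" "20 \<le> W"
  shows "\<exists>m \<le> 100 * vsize d * Suc (length s) * W. eval prog [d, code_list (map code_nat s)] (prog ! 8)
    (vbool (dterm_sat (set s) x)) m"
  using assms(1,2)
proof (induction x arbitrary: d)
  case (V a)
  then have d: "d = Pr Nl (code_nat a)" by (auto simp: tagged_def codes_nat_def)
  obtain m where "m \<le> 40 * Suc (length s) * W"
    and "eval prog [code_nat a, code_list (map code_nat s)] (prog ! 7)
      (vbool (a \<in> set s)) m" using eval_mem[of a W s] V assms d by auto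
  note m = this(1) and [simp] = eval_iff[OF this(2)]
  have "Suc (length s) * W \<le> vsize (code_nat a) * (Suc (length s) * W)"
    by simp
  then show ?case
    using m V assms(3-)
    unfolding d
    by (subst (2) prog_def) (simp add: eval_simps evals_simps algebra_simps vbool_def)
next
  case (Cup x y)
  then obtain dx dy where d: "d = Pr (code_nat 1) (Pr dx dy)" "dx \<in> codes_dterm x" "dy \<in> codes_dterm y"
    by (auto simp: tagged_def pairs_def)
  obtain m where "m \<le> 100 * vsize dx * Suc (length s) * W"
    and "eval prog [dx, code_list (map code_nat s)] (prog ! 8) (vbool (dterm_sat (set s) x)) m"
    using Cup d by force
  note m = this(1) and [simp] = eval_iff[OF this(2)]
  obtain k where "k \<le> 100 * vsize dy * Suc (length s) * W"
    and "eval prog [dy, code_list (map code_nat s)] (prog ! 8) (vbool (dterm_sat (set s) y)) k"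
    using Cup d by force
  note k = this(1) and [simp] = eval_iff[OF this(2)]
  show ?case
    using m k Cup.prems assms(3-)
    unfolding d
    by (subst (2) prog_def) (simp add: eval_simps evals_simps algebra_simps vbool_def)
next
  case (Cap x y)
  then obtain dx dy where d: "d = Pr (code_nat 2) (Pr dx dy)" "dx \<in> codes_dterm x" "dy \<in> codes_dterm y"
    by (auto simp: tagged_def pairs_def)
  obtain m where "m \<le> 100 * vsize dx * Suc (length s) * W"
    and "eval prog [dx, code_list (map code_nat s)] (prog ! 8) (vbool (dterm_sat (set s) x)) m"
    using Cap d by force
  note m = this(1) and [simp] = eval_iff[OF this(2)]
  obtain k where "k \<le> 100 * vsize dy * Suc (length s) * W"
    and "eval prog [dy, code_list (map code_nat s)] (prog ! 8) (vbool (dterm_sat (set s) y)) k"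
    using Cap d by force
  note k = this(1) and [simp] = eval_iff[OF this(2)]
  show ?case
    using m k Cap.prems assms(3-)
    unfolding d
    by (subst (2) prog_def) (simp add: eval_simps evals_simps algebra_simps vbool_def)
next
  case (Compl x)
  then obtain dx where d: "d = Pr (code_nat 3) dx" "dx \<in> codes_dterm x"
    by (auto simp: tagged_def pairs_def)
  obtain m where "m \<le> 100 * vsize dx * Suc (length s) * W"
    and "eval prog [dx, code_list (map code_nat s)] (prog ! 8) (vbool (dterm_sat (set s) x)) m"
    using Compl d by force
  note m = this(1) and [simp] = eval_iff[OF this(2)]
  show ?case
    using m Compl.prems assms(3-)
    unfolding d
    by (subst (2) prog_def) (simp add: eval_simps evals_simps algebra_simps vbool_def)
qed

section \<open>The sums for set constraints and the terms of linear constraints\<close>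

abbreviation code_nats :: "nat list \<Rightarrow> val" where
  "code_nats s \<equiv> code_list (map code_nat s)"

text \<open>The empty list is excluded because a formula has no free variable for the empty set.
  Lists are kept instead of sets since the enumeration may repeat a subset.\<close>

definition supports :: "nat dterm \<Rightarrow> nat list list \<Rightarrow> nat list list" where
  "supports x ss = filter (\<lambda>s. s \<noteq> [] \<and> dterm_sat (set s) x) ss"

text \<open>The summand with coefficient 1 and free variable \<open>SetVar (set s)\<close>: the
  first \<open>Nl\<close> is the sign of the coefficient, the second is the tag of
  \<open>Inl\<close>.\<close>

definition term_code :: "nat list \<Rightarrow> val" where
  "term_code s = Pr (Pr Nl (code_nat 1)) (Pr Nl (Pr (code_nat 1) (code_nats s)))"

lemma eval_terms:
  assumes d: "d \<in> codes_dterm x" "vsize d \<le> W" and "20 \<le> W"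
    and "\<forall>s \<in> set ss. length s \<le> n"
    and "vsize (code_list (map code_nats ss)) \<le> W"
    and "vsize (code_list (map term_code (supports x ss))) \<le> W"
  shows "\<exists>m \<le> (100 * vsize d * Suc n + 100) * Suc (length ss) * W.
    eval prog [d, code_list (map code_nats ss)] (prog ! 9)
      (code_list (map term_code (supports x ss))) m"
  using assms(3-)
proof (induction ss)
  case Nil
  then show ?case
    by (simp add: prog_def eval_simps algebra_simps trans_le_add1 supports_def)
next
  case (Cons s ss)
  have "vsize (code_list (map term_code (supports x ss))) \<le> W"
    using Cons.prems by (auto simp: supports_def split: if_splits)
  note prems = this Cons.prems
  then obtain m where "m \<le> (100 * vsize d * Suc n + 100) * Suc (length ss) * W"
    and "eval prog [d, code_list (map code_nats ss)] (prog ! 9)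
      (code_list (map term_code (supports x ss))) m"
    using Cons by auto
  note m = this(1) and [simp] = eval_iff[OF this(2)]
  obtain k where k: "k \<le> 100 * vsize d * Suc (length s) * W"
    and "eval prog [d, code_nats s] (prog ! 8) (vbool (dterm_sat (set s) x)) k"
    using eval_sat[of d x W s] d Cons.prems by auto
  note [simp] = eval_iff[OF this(2)]
  have "100 * vsize d * Suc (length s) * W \<le> 100 * vsize d * Suc n * W"
    using Cons.prems by (intro mult_left_mono mult_right_mono) auto
  with k have k: "k \<le> 100 * vsize d * Suc n * W" by linarith
  \<comment> \<open>The cost splits into the recursive call, the satisfaction test and a constant
    number of copies.\<close>
  have "\<exists>i \<le> m + k + 100 * W. eval prog [d, code_list (map code_nats (s # ss))] (prog ! 9)
      (code_list (map term_code (supports x (s # ss)))) i"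
  proof (cases s)
    case Nil
    show ?thesis
      using Cons.prems d
      by (subst (2) prog_def) (simp add: Nil supports_def eval_simps evals_simps del: vsize_pos)
  next
    case (Cons a s')
    then have [simp]: "code_nats s \<noteq> Nl" "s \<noteq> []" by auto
    have *: "supports x (s # ss) = (if dterm_sat (set s) x then s # supports x ss else supports x ss)"
      by (simp add: supports_def)
    show ?thesis
      using prems d unfolding *
      by (subst (2) prog_def, cases "dterm_sat (set s) x")
        (simp_all add: term_code_def vbool_def eval_simps evals_simps del: vsize_pos)
  qed
  moreover have "m + k + 100 * W \<le> (100 * vsize d * Suc n + 100) * Suc (length (s # ss)) * W"
    using m k by (simp add: algebra_simps)
  ultimately show ?case
    by (meson order_trans)
qed

text \<open>Acts directly on the codes of pairs of coefficient and variable: a term whose variable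
  is \<open>SetVar {}\<close> is dropped, and any other variable receives the tag 0 of
  \<open>Inl\<close>.\<close>

definition lift_code :: "val list \<Rightarrow> val" where
  "lift_code ds = code_list (map (\<lambda>d. Pr (vfst d) (Pr Nl (vsnd d)))
     (filter (\<lambda>d. vsnd d \<noteq> Pr (code_nat 1) Nl) ds))"

text \<open>A tag adds two nodes to an entry that is a pair. The factor 4 also covers an entry
  \<open>Nl\<close>, which grows from size 1 to 5.\<close>

lemma vsize_lift_code: "vsize (lift_code ds) \<le> 4 * vsize (code_list ds)"
proof (induction ds)
  case (Cons d ds)
  then show ?case
    by (cases d) (simp_all add: lift_code_def)
qed (simp add: lift_code_def)

lemma eval_lift:
  assumes "vsize (code_list ds) \<le> W" "20 \<le> W" "vsize (lift_code ds) \<le> W"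
  shows "\<exists>m \<le> 100 * Suc (length ds) * W.
    eval prog [code_list ds] (prog ! 10) (lift_code ds) m"
  using assms
proof (induction ds)
  case Nil
  then show ?case
    by (simp add: prog_def eval_simps algebra_simps trans_le_add1 lift_code_def)
next
  case (Cons d ds)
  have "vsize (lift_code ds) \<le> W"
    using Cons.prems by (auto simp: lift_code_def split: if_splits)
  then obtain m where "m \<le> 100 * Suc (length ds) * W"
    and "eval prog [code_list ds] (prog ! 10) (lift_code ds) m"
    using Cons by auto
  note m = this(1) and [simp] = eval_iff[OF this(2)]
  have *: "lift_code (d # ds) = (if vsnd d = Pr (code_nat 1) Nl then lift_code ds else
      Pr (Pr (vfst d) (Pr Nl (vsnd d))) (lift_code ds))"
    by (simp add: lift_code_def)
  have "vsize (vfst d) \<le> vsize d" "vsize (vsnd d) \<le> vsize d"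
    by (cases d; simp)+
  then show ?case
    using m Cons.prems
    unfolding *
    by (subst (2) prog_def, cases "vsnd d = Pr (code_nat 1) Nl")
      (simp_all add: eval_simps evals_simps algebra_simps vbool_def del: vsize_pos)
qed

text \<open>Nonemptiness is expressed by a sum of at least 1 instead of a negated equation, so that
  every constraint becomes one atom.\<close>

fun constr_lin :: "nat list list \<Rightarrow> nat constr \<Rightarrow> (nat cvar + nat) lin" where
  "constr_lin ss (IsEmpty x) = Lin (map (\<lambda>s. (1, Inl (SetVar (set s)))) (supports x ss)) EQ 0"
| "constr_lin ss (NonEmpty x) = Lin (map (\<lambda>s. (1, Inl (SetVar (set s)))) (supports x ss)) GE 1"
| "constr_lin ss (LinConstr (Lin ts r k)) =
     Lin (map (\<lambda>(c, v). (c, Inl v)) (filter (\<lambda>(c, v). v \<noteq> SetVar {}) ts)) r k"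

section \<open>Correctness and cost of the codes of the atoms\<close>

abbreviation "codes_var \<equiv> codes_sum codes_cvar codes_nat"

lemma codes_listI:
  "(\<And>x. x \<in> set xs \<Longrightarrow> f x \<in> c x) \<Longrightarrow> code_list (map f xs) \<in> codes_list c xs"
  by (auto simp: codes_list_def list_all2_conv_all_nth)

lemma codes_list_map: "codes_list c (map f xs) = codes_list (c \<circ> f) xs"
  by (simp add: codes_list_def list_all2_map2 comp_def)

lemma code_nats_codes: "set s = S \<Longrightarrow> code_nats s \<in> codes_set codes_nat S"
  unfolding codes_set_def by (auto intro!: bexI[of _ s] codes_listI simp: codes_nat_def)

lemma term_codes:
  "code_list (map term_code ss) \<in>
     codes_list (codes_prod codes_int codes_var) (map (\<lambda>s. (1, Inl (SetVar (set s)))) ss)"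
  unfolding codes_list_map using code_nats_codes
  by (intro codes_listI)
    (simp add: term_code_def codes_prod_def pairs_def codes_int_def vbool_def tagged_def)

text \<open>A number has exactly one code, so a code of a set of numbers is the same as a list
  enumerating it.\<close>

lemma codes_set_codes_nat:
  "d \<in> codes_set codes_nat X \<longleftrightarrow> (\<exists>xs. set xs = X \<and> d = code_nats xs)"
proof -
  have "list_all2 (\<lambda>d x. d \<in> codes_nat x) ds xs \<longleftrightarrow> ds = map code_nat xs" for ds xs
    by (auto simp: codes_nat_def list_all2_conv_all_nth list_eq_iff_nth_eq)
  then show ?thesis
    by (auto simp: codes_set_def codes_list_def)
qed

text \<open>Only the empty list enumerates the empty set, so \<open>SetVar {}\<close> has a single
  code and one comparison recognises it.\<close>

lemma SetVar_empty_code: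
  assumes "d \<in> codes_cvar v"
  shows "d = Pr (code_nat 1) Nl \<longleftrightarrow> v = SetVar {}"
proof -
  have "code_nats xs = Nl \<longleftrightarrow> xs = []" for xs
    by (cases xs) simp_all
  moreover obtain xs where "set xs = S" "d = Pr (code_nat 1) (code_nats xs)" if "v = SetVar S" for S
    using assms unfolding codes_set_codes_nat by (cases v) (auto simp: tagged_def codes_set_codes_nat)
  ultimately show ?thesis
    using assms by (cases v) (auto simp: tagged_def codes_nat_def)
qed

lemma lift_codes:
  assumes "list_all2 (\<lambda>d x. d \<in> codes_prod codes_int codes_cvar x) ds ts"
  shows "lift_code ds \<in> codes_list (codes_prod codes_int codes_var)
    (map (\<lambda>(c, v). (c, Inl v)) (filter (\<lambda>(c, v). v \<noteq> SetVar {}) ts))"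
  using assms
proof (induction rule: list_all2_induct)
  case Nil
  then show ?case by (simp add: lift_code_def codes_list_def)
next
  case (Cons d ds x ts)
  obtain c v where x: "x = (c, v)" by (cases x)
  with Cons obtain e f where d: "d = Pr e f" "e \<in> codes_int c" "f \<in> codes_cvar v"
    by (auto simp: codes_prod_def pairs_def)
  have cons: "Pr d e \<in> codes_list c (x # xs)" if "d \<in> c x" "e \<in> codes_list c xs" for d e c x xs
    using that by (force simp: codes_list_def intro: exI[of _ "d # _"])
  from Cons.IH show ?case
    using SetVar_empty_code[OF d(3)]
    by (auto simp: lift_code_def x d codes_prod_def pairs_def tagged_def intro!: cons)
qed

text \<open>In the size bound, \<open>4 * n\<close> covers a rewritten linear constraint, and the
  factor \<open>Suc (length ss)\<close> covers the sums with one summand per subset. The bound is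
  uniform in the kind of constraint.\<close>

lemma eval_constr:
  assumes g: "d \<in> codes_constr g" "vsize d \<le> n"
    and s: "\<forall>s \<in> set ss. vsize (code_nats s) \<le> n"
    and W: "vsize (code_list (map code_nats ss)) \<le> W" "Suc (length ss) * (4 * n + 40) \<le> W"
  shows "\<exists>e \<in> codes_qfree codes_var (Atom (constr_lin ss g)). vsize e \<le> Suc (length ss) * (4 * n + 40) \<and>
    (\<exists>m \<le> (100 * Suc n * Suc n + 200) * Suc (length ss) * W.
      eval prog [d, code_list (map code_nats ss)] (prog ! 11) e m)"
proof -
  have W20: "20 \<le> W" "n \<le> W" using W(2) by auto
  \<comment> \<open>A summand exceeds the code of \<open>s\<close> by 16 nodes and the list cell
    adds one more, so \<open>n + 20\<close> per subset suffices.\<close>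
  have sup: "vsize (code_list (map term_code (supports x ss))) \<le> Suc (length ss * (n + 20))" for x
  proof -
    have "vsize (code_list (map term_code (supports x ss)))
        \<le> Suc (length (map term_code (supports x ss)) * Suc (n + 19))"
      using s by (intro vsize_code_list_le) (auto simp: term_code_def supports_def)
    also have "\<dots> \<le> Suc (length ss * Suc (n + 19))"
      by (intro Suc_le_mono[THEN iffD2] mult_right_mono) (auto simp: supports_def)
    finally show ?thesis by (simp add: algebra_simps)
  qed
  then have supW: "vsize (code_list (map term_code (supports x ss))) + 20 \<le> W" for x
  proof -
    have "Suc (length ss * (n + 20)) + 20 \<le> Suc (length ss) * (4 * n + 40)"
      by (simp add: algebra_simps)
    then show ?thesis using sup[of x] W(2) by linarith
  qed
  have len: "\<forall>s \<in> set ss. length s \<le> n"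
    using s length_less_vsize by (metis length_map less_le_trans less_imp_le)
  have terms: "\<exists>m \<le> (100 * Suc n * Suc n + 100) * Suc (length ss) * W.
      eval prog [d', code_list (map code_nats ss)] (prog ! 9)
      (code_list (map term_code (supports x ss))) m" if d': "d' \<in> codes_dterm x" "vsize d' \<le> n" for d' x
  proof -
    obtain m where m: "m \<le> (100 * vsize d' * Suc n + 100) * Suc (length ss) * W"
      "eval prog [d', code_list (map code_nats ss)] (prog ! 9)
      (code_list (map term_code (supports x ss))) m"
      using eval_terms[OF d'(1), of W ss n] d'(2) W20 len W(1) supW[of x] by auto
    have "(100 * vsize d' * Suc n + 100) * Suc (length ss) * W
       \<le> (100 * Suc n * Suc n + 100) * Suc (length ss) * W"
      using d' by (intro mult_right_mono add_right_mono) auto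
    with m show ?thesis by (meson order_trans)
  qed
  have bound: "m + 100 * W \<le> (100 * Suc n * Suc n + 200) * Suc (length ss) * W"
    if "m \<le> (100 * Suc n * Suc n + 100) * Suc (length ss) * W" for m
    using that by (simp add: algebra_simps)
  show ?thesis
  proof (cases g)
    case (IsEmpty x)
    then obtain d' where d: "d = Pr Nl d'" "d' \<in> codes_dterm x" "vsize d' \<le> n"
      using g by (auto simp: tagged_def)
    from terms[OF d(2,3)] obtain m where "m \<le> (100 * Suc n * Suc n + 100) * Suc (length ss) * W"
      and "eval prog [d', code_list (map code_nats ss)] (prog ! 9)
      (code_list (map term_code (supports x ss))) m" by auto
    note m = this(1) and [simp] = eval_iff[OF this(2)]
    let ?e = "Pr Nl (Pr (code_list (map term_code (supports x ss))) (Pr (code_nat 2) (Pr Nl Nl)))"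
    have "?e \<in> codes_qfree codes_var (Atom (constr_lin ss g))"
      using term_codes by (auto simp: IsEmpty tagged_def pairs_def codes_int_def vbool_def)
    moreover have "vsize ?e \<le> Suc (length ss) * (4 * n + 40)"
    proof -
      have "Suc (length ss * (n + 20)) + 20 \<le> Suc (length ss) * (4 * n + 40)"
        by (simp add: algebra_simps)
      then show ?thesis using sup[of x] by simp
    qed
    moreover have "\<exists>i \<le> m + 100 * W.
      eval prog [d, code_list (map code_nats ss)] (prog ! 11) ?e i"
      using W(1) supW[of x] g(2) W20
      unfolding d
      by (subst (2) prog_def) (simp add: eval_simps evals_simps vbool_def)
    ultimately show ?thesis using bound[OF m] by (meson order_trans)
  next
    case (NonEmpty x)
    then obtain d' where d: "d = Pr (code_nat 1) d'" "d' \<in> codes_dterm x" "vsize d' \<le> n"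
      using g by (auto simp: tagged_def)
    from terms[OF d(2,3)] obtain m where "m \<le> (100 * Suc n * Suc n + 100) * Suc (length ss) * W"
      and "eval prog [d', code_list (map code_nats ss)] (prog ! 9)
      (code_list (map term_code (supports x ss))) m" by auto
    note m = this(1) and [simp] = eval_iff[OF this(2)]
    let ?e = "Pr Nl (Pr (code_list (map term_code (supports x ss))) (Pr (code_nat 3) (Pr Nl (code_nat 1))))"
    have "?e \<in> codes_qfree codes_var (Atom (constr_lin ss g))"
      using term_codes by (auto simp: NonEmpty tagged_def pairs_def codes_int_def vbool_def)
    moreover have "vsize ?e \<le> Suc (length ss) * (4 * n + 40)"
    proof -
      have "Suc (length ss * (n + 20)) + 20 \<le> Suc (length ss) * (4 * n + 40)"
        by (simp add: algebra_simps)
      then show ?thesis using sup[of x] by simp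
    qed
    moreover have "\<exists>i \<le> m + 100 * W.
      eval prog [d, code_list (map code_nats ss)] (prog ! 11) ?e i"
      using W(1) supW[of x] g(2) W20
      unfolding d
      by (subst (2) prog_def) (simp add: eval_simps evals_simps vbool_def)
    ultimately show ?thesis using bound[OF m] by (meson order_trans)
  next
    case (LinConstr l)
    obtain ts r k where l: "l = Lin ts r k" by (cases l)
    obtain ds d1 d2 where d: "d = Pr (code_nat 2) (Pr (code_list ds) (Pr d1 d2))"
      and ds: "list_all2 (\<lambda>d x. d \<in> codes_prod codes_int codes_cvar x) ds ts"
      and d12: "d1 \<in> codes_cmp r" "d2 \<in> codes_int k"
      using g by (auto simp: LinConstr l tagged_def pairs_def codes_list_def)
    let ?e = "Pr Nl (Pr (lift_code ds) (Pr d1 d2))"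
    have liftW: "vsize (lift_code ds) + 2 * vsize d1 + 2 * vsize d2 \<le> 4 * n"
      using vsize_lift_code[of ds] g(2) d by simp
    also have "\<dots> \<le> W" using W(2) by simp
    finally have "vsize (lift_code ds) \<le> W" by simp
    with eval_lift[of ds W] obtain m where m: "m \<le> 100 * Suc (length ds) * W"
      and "eval prog [code_list ds] (prog ! 10) (lift_code ds) m"
      using g(2) d W20 by auto
    note [simp] = eval_iff[OF this(2)]
    have "?e \<in> codes_qfree codes_var (Atom (constr_lin ss g))"
      using lift_codes[OF ds] d12 by (auto simp: LinConstr l tagged_def pairs_def)
    moreover have "vsize ?e \<le> Suc (length ss) * (4 * n + 40)"
      using liftW vsize_pos[of d1] by (simp add: algebra_simps)
    moreover have "\<exists>i \<le> m + 100 * W.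
      eval prog [d, code_list (map code_nats ss)] (prog ! 11) ?e i"
      using W(1) g(2) W20 liftW \<open>4 * n \<le> W\<close>
      unfolding d
      by (subst (2) prog_def) (simp add: eval_simps evals_simps vbool_def)
    moreover have "m \<le> (100 * Suc n * Suc n + 100) * Suc (length ss) * W"
    proof -
      \<comment> \<open>A linear constraint has fewer terms than its code has nodes, so its linear
        cost fits under the quadratic bound used for set constraints.\<close>
      have "Suc (length ds) \<le> n" using length_less_vsize[of ds] g(2) d by simp
      also have "\<dots> \<le> Suc n * Suc n" by simp
      finally have "100 * Suc (length ds) * W \<le> 100 * (Suc n * Suc n) * W"
        by (intro mult_right_mono mult_left_mono) auto
      with m show ?thesis by (simp add: algebra_simps)
    qed
    note bound[OF this]
    ultimately show ?thesis by (meson order_trans)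
  qed
qed

text \<open>The equation of the empty sum with 0 is valid and plays the part of truth.\<close>

fun constrs_formula :: "nat list list \<Rightarrow> nat constr list \<Rightarrow> (nat cvar + nat) qfree" where
  "constrs_formula ss [] = Atom (Lin [] EQ 0)"
| "constrs_formula ss (g # gs) = Conj (Atom (constr_lin ss g)) (constrs_formula ss gs)"

lemma eval_formula:
  assumes "list_all2 (\<lambda>d g. d \<in> codes_constr g) ds gs" "vsize (code_list ds) \<le> n"
    and s: "\<forall>s \<in> set ss. vsize (code_nats s) \<le> n"
    and W: "vsize (code_list (map code_nats ss)) \<le> W"
      "Suc (length ds) * (Suc (length ss) * (4 * n + 60)) \<le> W"
  shows "\<exists>e \<in> codes_qfree codes_var (constrs_formula ss gs).
    vsize e \<le> Suc (length ds) * (Suc (length ss) * (4 * n + 60)) \<and>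
    (\<exists>m \<le> Suc (length ds) * ((100 * Suc n * Suc n + 300) * Suc (length ss) * W).
      eval prog [code_list ds, code_list (map code_nats ss)] (prog ! 12) e m)"
  using assms(1,2,5)
proof (induction rule: list_all2_induct)
  case Nil
  then have "20 \<le> W" by simp
  let ?e = "Pr Nl (Pr Nl (Pr (code_nat 2) (Pr Nl Nl)))"
  have "?e \<in> codes_qfree codes_var (constrs_formula ss [])"
    by (auto simp: tagged_def pairs_def codes_int_def vbool_def codes_list_def)
  moreover have "vsize ?e \<le> Suc (length ss) * (4 * n + 60)"
    by (simp add: algebra_simps)
  moreover have "\<exists>m \<le> (100 * Suc n * Suc n + 300) * Suc (length ss) * W.
      eval prog [code_list [], code_list (map code_nats ss)] (prog ! 12) ?e m"
    unfolding code_list.simps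
    using \<open>20 \<le> W\<close>
    by (subst (2) prog_def) (simp add: eval_simps evals_simps vbool_def, simp add: algebra_simps)
  ultimately show ?case unfolding list.size One_nat_def[symmetric] mult_1 by blast
next
  case (Cons d ds g gs)
  let ?B = "Suc (length ss) * (4 * n + 60)"
  \<comment> \<open>The conjunction adds its tag and two pairs, 9 nodes in all, which the surplus of
    20 per constraint covers.\<close>
  have B: "Suc (length ss) * (4 * n + 40) + 20 \<le> ?B"
    by (simp add: algebra_simps)
  have W': "?B + Suc (length ds) * ?B \<le> W"
    using Cons.prems(2) by simp
  then have "Suc (length ds) * ?B \<le> W" by linarith
  with Cons obtain e m where e: "e \<in> codes_qfree codes_var (constrs_formula ss gs)"
     "vsize e \<le> Suc (length ds) * ?B"
    and m: "m \<le> Suc (length ds) * ((100 * Suc n * Suc n + 300) * Suc (length ss) * W)"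
      "eval prog [code_list ds, code_list (map code_nats ss)] (prog ! 12) e m"
    by auto
  note [simp] = eval_iff[OF m(2)]
  obtain f k where f: "f \<in> codes_qfree codes_var (Atom (constr_lin ss g))"
    "vsize f \<le> Suc (length ss) * (4 * n + 40)"
    and k: "k \<le> (100 * Suc n * Suc n + 200) * Suc (length ss) * W"
      "eval prog [d, code_list (map code_nats ss)] (prog ! 11) f k"
  proof -
    have "Suc (length ss) * (4 * n + 40) \<le> W" using W' B by linarith
    moreover have "vsize d \<le> n" using Cons.prems(1) by simp
    ultimately show ?thesis
      using eval_constr[OF Cons.hyps(1) _ s W(1)] that by blast
  qed
  note [simp] = eval_iff[OF k(2)]
  let ?e = "Pr (code_nat 2) (Pr f e)"
  have "?e \<in> codes_qfree codes_var (constrs_formula ss (g # gs))"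
    using e f by (auto simp: tagged_def pairs_def)
  moreover have e': "vsize ?e \<le> Suc (length (d # ds)) * ?B"
  proof -
    have "vsize ?e = vsize f + vsize e + 9" by simp
    moreover have "Suc (length (d # ds)) * ?B = ?B + Suc (length ds) * ?B" by simp
    ultimately show ?thesis using e(2) f(2) B by linarith
  qed
  moreover have "\<exists>i \<le> m + k + 100 * W.
      eval prog [code_list (d # ds), code_list (map code_nats ss)] (prog ! 12) ?e i"
  proof -
    have "Suc (length (d # ds)) * ?B \<le> W"
      using Cons.prems(2) by simp
    with e' have "vsize ?e \<le> W" by linarith
    moreover have "n \<le> W" using W' by simp
    with Cons.prems have "vsize (code_list (d # ds)) \<le> W" by linarith
    moreover have "20 \<le> W" using W' by simp
    ultimately show ?thesis
      using W(1)
      by (subst (2) prog_def) (simp add: eval_simps evals_simps)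
  qed
  moreover have "m + k + 100 * W
      \<le> Suc (length (d # ds)) * ((100 * Suc n * Suc n + 300) * Suc (length ss) * W)"
    using m(1) k(1) by (simp add: algebra_simps)
  ultimately show ?case by (meson order_trans)
qed

section \<open>Trees and their data values\<close>

lemma children_map_tree [simp]: "children (map_tree f t) = map (map_tree f) (children t)"
  by (cases t) simp

lemma root_map_tree [simp]: "root (map_tree f t) = f (root t)"
  by (cases t) simp

lemma is_node_map_tree [simp]: "is_node (map_tree f t) u = is_node t u"
  by (induction u arbitrary: t) (simp_all cong: conj_cong)

lemma nodes_map_tree [simp]: "nodes (map_tree f t) = nodes t"
  by (simp add: nodes_def)

lemma lab_map_tree: "u \<in> nodes t \<Longrightarrow> lab (map_tree f t) u = f (lab t u)"
  unfolding nodes_def lab_def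
  by (induction u arbitrary: t) simp_all

text \<open>Addresses and labels determine a tree: the addresses starting with \<open>i\<close>
  describe the \<open>i\<close>-th subtree, to which the induction hypothesis applies.\<close>

lemma tree_eqI:
  assumes "nodes t = nodes t'" "\<And>u. u \<in> nodes t \<Longrightarrow> lab t u = lab t' u"
  shows "t = t'"
  using assms
proof (induction t arbitrary: t')
  case (Node a ts)
  obtain b ts' where t': "t' = Node b ts'" by (cases t')
  have sub: "i # u \<in> nodes (Node c us) \<longleftrightarrow> i < length us \<and> u \<in> nodes (us ! i)" for i u c us
    by (simp add: nodes_def)
  have "[] \<in> nodes t" for t :: "'a tree" by (simp add: nodes_def)
  then have "a = b" using Node.prems(2)[of "[]"] by (simp add: lab_def t')
  \<comment> \<open>The addresses of length one are the positions of the children, so they fix the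
    arity of the root.\<close>
  moreover have "i < length ts \<longleftrightarrow> i < length ts'" for i
    using arg_cong[OF Node.prems(1), of "\<lambda>N. [i] \<in> N"] by (simp add: t' nodes_def)
  then have len: "length ts = length ts'"
    by (metis linorder_neqE_nat less_irrefl)
  moreover have "ts ! i = ts' ! i" if i: "i < length ts" for i
  proof (rule Node.IH)
    show "ts ! i \<in> set ts" using i by simp
    show "nodes (ts ! i) = nodes (ts' ! i)"
      using Node.prems(1) i len unfolding t' by (metis sub set_eqI)
    show "lab (ts ! i) u = lab (ts' ! i) u" if "u \<in> nodes (ts ! i)" for u
      using Node.prems(2)[of "i # u"] that i by (simp add: sub lab_def t')
  qed
  ultimately show ?case by (simp add: t' nth_equalityI)
qed

lemma odtree_eqI:
  assumes "Proj t = Proj t'" "Data t = Data t'"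
  shows "t = t'"
proof (rule tree_eqI)
  show "nodes t = nodes t'"
    using assms(1) unfolding Proj_def by (metis nodes_map_tree)
  then show "lab t u = lab t' u" if "u \<in> nodes t" for u
    using that assms unfolding Proj_def Data_def by (metis lab_map_tree prod_eqI)
qed

section \<open>Brackets, value words and the values of data terms\<close>

lemma finite_nodes: "finite (nodes t)"
proof (induction t)
  case (Node a ts)
  have "nodes (Node a ts) \<subseteq> insert [] (\<Union>i<length ts. (#) i ` nodes (ts ! i))"
  proof
    fix u assume "u \<in> nodes (Node a ts)"
    then show "u \<in> insert [] (\<Union>i<length ts. (#) i ` nodes (ts ! i))"
      by (cases u) (auto simp: nodes_def)
  qed
  then show ?case using Node by (auto intro: finite_subset)
qed

lemma finite_all_vals: "finite (all_vals t)"
proof -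
  have "all_vals t = (\<lambda>u. snd (lab t u)) ` nodes t"
    by (auto simp: all_vals_def Vals_def label_nodes_def)
  then show ?thesis by (simp add: finite_nodes)
qed

lemma Bracket_iff:
  assumes "S \<subseteq> \<Gamma>"
  shows "d \<in> Bracket \<Gamma> t S \<longleftrightarrow> d \<in> all_vals t \<and> S = {a \<in> \<Gamma>. d \<in> Vals t a}"
  using assms by (auto simp: Bracket_def)

text \<open>Every data value is carried by some node, and the label of that node lies in
  \<Gamma>.\<close>

lemma Bracket_empty:
  assumes "t \<in> odtrees_over \<Gamma>"
  shows "Bracket \<Gamma> t {} = {}"
  using assms by (auto simp: Bracket_def all_vals_def Vals_def label_nodes_def odtrees_over_def)

lemma value_word_eq:
  "value_word \<Gamma> t = map (\<lambda>d. {a \<in> \<Gamma>. d \<in> Vals t a}) (sorted_list_of_set (all_vals t))"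
  unfolding value_word_def
proof (rule map_cong[OF refl])
  fix d assume "d \<in> set (sorted_list_of_set (all_vals t))"
  then have "d \<in> all_vals t" by (simp add: finite_all_vals)
  then show "(THE S. S \<subseteq> \<Gamma> \<and> d \<in> Bracket \<Gamma> t S) = {a \<in> \<Gamma>. d \<in> Vals t a}"
    by (intro the_equality) (auto simp: Bracket_iff)
qed

lemma count_list_map_distinct:
  "distinct xs \<Longrightarrow> count_list (map f xs) y = card {x \<in> set xs. f x = y}"
proof (induction xs)
  case (Cons x xs)
  have "{z \<in> set (x # xs). f z = y} =
      (if f x = y then insert x {z \<in> set xs. f z = y} else {z \<in> set xs. f z = y})"
    by auto
  with Cons show ?case by simp
qed simp

text \<open>Each data value contributes exactly one letter to the value word, so the Parikh count of
  \<open>S\<close> is the number counted by the variable of \<open>S\<close> in a linear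
  constraint.\<close>

lemma count_value_word:
  assumes "S \<subseteq> \<Gamma>"
  shows "count_list (value_word \<Gamma> t) S = card (Bracket \<Gamma> t S)"
proof -
  have "Bracket \<Gamma> t S = {d \<in> all_vals t. {a \<in> \<Gamma>. d \<in> Vals t a} = S}"
    using assms by (auto simp: Bracket_iff)
  then show ?thesis
    by (simp add: value_word_eq count_list_map_distinct finite_all_vals)
qed

lemma dterm_val_iff:
  assumes "set_dterm x \<subseteq> \<Sigma>"
  shows "d \<in> dterm_val t x \<longleftrightarrow> d \<in> all_vals t \<and> dterm_sat {a \<in> \<Sigma>. d \<in> Vals t a} x"
  using assms by (induction x) (auto simp: all_vals_def)

lemma dterm_val_empty_iff:
  assumes t: "t \<in> odtrees_over \<Sigma>" and x: "set_dterm x \<subseteq> \<Sigma>"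
  shows "dterm_val t x = {} \<longleftrightarrow>
    (\<forall>S \<subseteq> \<Sigma>. S \<noteq> {} \<and> dterm_sat S x \<longrightarrow> Bracket \<Sigma> t S = {})"
proof -
  \<comment> \<open>The brackets partition the data values, and a term is the union of the brackets
    of the sets satisfying it. The bracket of the empty set contributes nothing.\<close>
  have "dterm_val t x = \<Union> (Bracket \<Sigma> t ` {S. S \<subseteq> \<Sigma> \<and> dterm_sat S x})"
    using x by (auto simp: dterm_val_iff Bracket_iff)
  then show ?thesis
    using Bracket_empty[OF t] by (smt (verit) SUP_bot_conv(1) mem_Collect_eq)
qed

section \<open>The weak ODTA with the identity transducer\<close>

definition id_wodta :: "'a uta \<Rightarrow> ('a, 'a) wodta" where
  "id_wodta A = \<lparr>
     wo_td = \<lparr>td_uta = A, td_out_alph = uta_alph A,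
       td_out = {(q, a, a) | q a. q \<in> uta_states A \<and> a \<in> uta_alph A}\<rparr>,
     wo_nfa = \<lparr>nfa_states = {0}, nfa_trans = {0} \<times> Pow (uta_alph A) \<times> {0},
       nfa_init = {0}, nfa_final = {0}\<rparr>,
     wo_dist = {}\<rparr>"

lemma wf_id_wodta:
  assumes "wf_uta A"
    and "free_vars \<phi> \<subseteq> LetterVar ` uta_alph A \<union> SetVar ` (Pow (uta_alph A) - {{}})"
  shows "wf_ext_wodta (uta_alph A) (id_wodta A) \<phi>"
  using assms
  by (auto simp: wf_ext_wodta_def id_wodta_def Let_def wf_transducer_def nfa_over_def wf_uta_def)

lemma id_wodta_accepts:
  assumes "t \<in> odtrees_over (uta_alph A)"
  shows "ext_wodta_accepts (id_wodta A) \<phi> t \<longleftrightarrow>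
    uta_accepts A (Proj t) \<and> expresb_sat (parikh_count (uta_alph A) t) \<phi>"
proof -
  let ?\<Sigma> = "uta_alph A"
  \<comment> \<open>The output relation equates the labels at every node, so a tree has no output
    other than itself. Together with the preserved data values this forces the tree
    \<open>t'\<close> to be \<open>t\<close>.\<close>
  have out: "is_output (wo_td (id_wodta A)) s s' \<longleftrightarrow> uta_accepts A s \<and> s' = s" for s s'
  proof
    assume "is_output (wo_td (id_wodta A)) s s'"
    then show "uta_accepts A s \<and> s' = s"
      by (auto simp: is_output_def id_wodta_def uta_accepts_def intro!: tree_eqI)
  next
    assume "uta_accepts A s \<and> s' = s"
    then show "is_output (wo_td (id_wodta A)) s s'"
      by (auto simp: is_output_def id_wodta_def uta_accepts_def accepting_run_def)
  qed
  have "nfa_reach (wo_nfa (id_wodta A)) 0 w 0" if "set w \<subseteq> Pow ?\<Sigma>" for w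
    using that by (induction w) (auto simp: id_wodta_def)
  moreover have "set (value_word ?\<Sigma> t) \<subseteq> Pow ?\<Sigma>"
    by (auto simp: value_word_eq)
  ultimately have "nfa_reach (wo_nfa (id_wodta A)) 0 (value_word ?\<Sigma> t) 0"
    by blast
  then have "value_word ?\<Sigma> t \<in> nfa_lang (wo_nfa (id_wodta A))"
    unfolding nfa_lang_def by (auto simp: id_wodta_def)
  moreover have "td_out_alph (wo_td (id_wodta A)) = ?\<Sigma>" "wo_dist (id_wodta A) = {}"
    by (simp_all add: id_wodta_def)
  ultimately have "ext_wodta_accepts (id_wodta A) \<phi> t \<longleftrightarrow> (\<exists>t'. t' = t \<and>
      uta_accepts A (Proj t) \<and> expresb_sat (parikh_count ?\<Sigma> t) \<phi>)"
    unfolding ext_wodta_accepts_def Let_def out using assms odtree_eqI[of _ t] by auto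
  then show ?thesis by blast
qed

section \<open>The formula for the constraints\<close>

lemma constr_count_eq:
  assumes "t \<in> odtrees_over \<Sigma>" "v \<in> LetterVar ` \<Sigma> \<union> SetVar ` Pow \<Sigma>"
  shows "constr_count \<Sigma> t v = (if v = SetVar {} then 0 else parikh_count \<Sigma> t v)"
  using assms by (auto simp: Bracket_empty count_value_word)

lemma set_lin_Lin: "set_lin (Lin ts r k) = snd ` set ts"
  by (auto simp: prod_set_defs image_iff)

text \<open>A sum of naturals vanishes iff all its summands do, which depends only on the set of
  summands and not on repetitions in \<open>ss\<close>.\<close>

lemma sum_supports:
  assumes t: "t \<in> odtrees_over \<Sigma>" and ss: "set ` set ss = Pow \<Sigma>" and x: "set_dterm x \<subseteq> \<Sigma>"
  shows "(\<Sum>s\<leftarrow>supports x ss. parikh_count \<Sigma> t (SetVar (set s))) = 0 \<longleftrightarrow> dterm_val t x = {}"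
proof -
  \<comment> \<open>Finiteness makes cardinality 0 equivalent to emptiness.\<close>
  have fin: "finite (Bracket \<Sigma> t S)" for S
    using finite_all_vals by (rule finite_subset[rotated]) (auto simp: Bracket_def)
  have "(\<Sum>s\<leftarrow>supports x ss. parikh_count \<Sigma> t (SetVar (set s))) = 0 \<longleftrightarrow>
      (\<forall>s \<in> set ss. set s \<noteq> {} \<and> dterm_sat (set s) x \<longrightarrow> parikh_count \<Sigma> t (SetVar (set s)) = 0)"
    by (auto simp: supports_def)
  also have "\<dots> \<longleftrightarrow> (\<forall>S \<in> set ` set ss. S \<noteq> {} \<and> dterm_sat S x \<longrightarrow> parikh_count \<Sigma> t (SetVar S) = 0)"
    by simp
  also have "\<dots> \<longleftrightarrow> (\<forall>S \<subseteq> \<Sigma>. S \<noteq> {} \<and> dterm_sat S x \<longrightarrow> Bracket \<Sigma> t S = {})"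
    unfolding ss by (auto simp: count_value_word fin)
  finally show ?thesis
    using dterm_val_empty_iff[OF t x] by simp
qed

text \<open>The atom contains only free variables, so the valuation \<open>w\<close> of the
  quantified ones is arbitrary. The dropped terms have value 0.\<close>

lemma lin_sat_constr_lin:
  assumes t: "t \<in> odtrees_over \<Sigma>" and ss: "set ` set ss = Pow \<Sigma>" and g: "constr_over \<Sigma> g"
  shows "lin_sat (case_sum (parikh_count \<Sigma> t) w) (constr_lin ss g) \<longleftrightarrow> constr_sat \<Sigma> t g"
proof (cases g)
  case (LinConstr l)
  obtain ts r k where l: "l = Lin ts r k" by (cases l)
  have "\<forall>(c, v) \<in> set ts. v \<in> LetterVar ` \<Sigma> \<union> SetVar ` Pow \<Sigma>"
    using g by (auto simp: LinConstr l set_lin_Lin simp del: lin.set)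
  then have "(\<Sum>(c, v)\<leftarrow>map (\<lambda>(c, v). (c, Inl v)) (filter (\<lambda>(c, v). v \<noteq> SetVar {}) ts).
      c * int (case_sum (parikh_count \<Sigma> t) w v)) = (\<Sum>(c, v)\<leftarrow>ts. c * int (constr_count \<Sigma> t v))"
    by (induction ts) (auto simp: constr_count_eq[OF t]
        simp del: constr_count.simps parikh_count.simps split: if_splits)
  then show ?thesis by (simp add: LinConstr l)
next
  case (IsEmpty x)
  have "(\<Sum>(c, v)\<leftarrow>map (\<lambda>s. (1, Inl (SetVar (set s)))) ss.
      c * int (case_sum (parikh_count \<Sigma> t) w v)) =
      int (\<Sum>s\<leftarrow>ss. parikh_count \<Sigma> t (SetVar (set s)))" for ss
    by (induction ss) auto
  with sum_supports[OF t ss] g show ?thesis by (simp add: IsEmpty del: parikh_count.simps)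
next
  case (NonEmpty x)
  have "(\<Sum>(c, v)\<leftarrow>map (\<lambda>s. (1, Inl (SetVar (set s)))) ss.
      c * int (case_sum (parikh_count \<Sigma> t) w v)) =
      int (\<Sum>s\<leftarrow>ss. parikh_count \<Sigma> t (SetVar (set s)))" for ss
    by (induction ss) auto
  with sum_supports[OF t ss] g show ?thesis
    by (simp add: NonEmpty Suc_le_eq zero_less_iff_neq_zero
        del: parikh_count.simps sum_list_eq_0_iff neq0_conv)
qed

lemma constrs_formula_sat:
  "qfree_sat \<nu> (constrs_formula ss gs) \<longleftrightarrow> (\<forall>g \<in> set gs. lin_sat \<nu> (constr_lin ss g))"
  by (induction gs) auto

lemma free_vars_constrs_formula:
  assumes "set ` set ss = Pow \<Sigma>" "\<forall>g \<in> set gs. constr_over \<Sigma> g"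
  shows "free_vars (Ex_prefix (constrs_formula ss gs)) \<subseteq> LetterVar ` \<Sigma> \<union> SetVar ` (Pow \<Sigma> - {{}})"
proof -
  have subset: "set s \<subseteq> \<Sigma>" if "s \<in> set ss" for s
    using that assms(1) by blast
  have "v \<in> LetterVar ` \<Sigma> \<union> SetVar ` (Pow \<Sigma> - {{}})"
    if v: "Inl v \<in> set_lin (constr_lin ss g)" and g: "constr_over \<Sigma> g" for g v
  proof (cases g)
    case (LinConstr l)
    then show ?thesis using v g by (cases l) (auto simp: set_lin_Lin simp del: lin.set)
  qed (use v subset in \<open>auto simp: supports_def set_lin_Lin image_iff simp del: lin.set\<close>)
  then show ?thesis
    using assms(2) unfolding free_vars_def by (induction gs) auto
qed

section \<open>Computing the code of the output\<close>

text \<open>The program enumerates sublists of the list of letter codes; this identifies the result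
  with the codes of the sublists of letters.\<close>

lemma subseqs_map: "subseqs (map f xs) = map (map f) (subseqs xs)"
  by (induction xs) (simp_all add: Let_def comp_def)

lemma vsize_subseqs: "s \<in> set (subseqs as) \<Longrightarrow> vsize (code_nats s) \<le> vsize (code_nats as)"
proof (induction as arbitrary: s)
  case (Cons a as)
  then show ?case by (force simp: Let_def)
qed simp

text \<open>\<open>Pr Nl Nl\<close> is the code of the set {0}, used for the states, the initial
  states and the final states.\<close>

abbreviation nfa_code :: "nat list list \<Rightarrow> val" where
  "nfa_code ss \<equiv> Pr (Pr Nl Nl) (Pr (code_list (map (\<lambda>s. Pr Nl (Pr s Nl)) (map code_nats ss)))
     (Pr (Pr Nl Nl) (Pr Nl Nl)))"

abbreviation diagonal_code :: "nat list \<Rightarrow> nat list \<Rightarrow> val" where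
  "diagonal_code qs as \<equiv>
     code_list (concat (map (\<lambda>q. map (\<lambda>a. Pr q (Pr a a)) (map code_nat as)) (map code_nat qs)))"

text \<open>The entry function passes the list of subsets as an argument, so that it is computed
  once and shared by the string automaton and the formula.\<close>

lemma eval_main:
  assumes "eval prog [a] (prog ! 5) ss k" "eval prog [Pr a v, d, ss] (prog ! 1) out m"
    and "vsize (Pr (Pr a v) d) \<le> W" "vsize ss \<le> W"
  shows "\<exists>i \<le> m + k + 100 * W. computes prog (Pr (Pr a v) d) out i"
proof -
  \<comment> \<open>The simplifier writes the index 1 as \<open>Suc 0\<close>, and the rewrite rule
    has to match that form.\<close>
  note [simp] = eval_iff[OF assms(1)] eval_iff[OF assms(2)[unfolded One_nat_def]]
  have "\<exists>i \<le> m + k + 50 * W. eval prog [Pr (Pr a v) d] (prog ! 0) out i"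
    using assms(3,4)
    by (subst (2) prog_def) (simp add: eval_simps evals_simps)
  then obtain i where i: "i \<le> m + k + 50 * W" "eval prog [Pr (Pr a v) d] (prog ! 0) out i"
    by blast
  note [simp] = eval_iff[OF i(2)]
  show ?thesis
    using i(1) assms(3) unfolding computes_def by (simp add: eval_simps evals_simps)
qed

lemma computes_output:
  assumes inp: "inp = Pr u (code_list ds)" and u: "u = Pr (code_nats as) (Pr (code_nats qs) v)"
    and ds: "list_all2 (\<lambda>d g. d \<in> codes_constr g) ds gs"
  shows "\<exists>e \<in> codes_qfree codes_var (constrs_formula (subseqs as) gs).
    \<exists>m \<le> 2 ^ (22 * vsize inp + 22). computes prog inp
      (Pr (Pr (Pr u (Pr (code_nats as) (diagonal_code qs as)))
         (Pr (nfa_code (subseqs as)) Nl)) e) m"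
proof -
  define n where "n = vsize inp"
  define E :: nat where "E = 2 ^ n"
  \<comment> \<open>\<open>E\<close> exceeds the input size and bounds the number of subsets. All
    values that occur have size at most cubic in \<open>E\<close>; the number of steps for the
    formula is of order \<open>E ^ 4\<close>.\<close>
  define W where "W = 1000 * E ^ 4"
  let ?ss = "subseqs as"
  have n: "n < E" unfolding E_def by (rule less_exp)
  have "vsize inp \<le> n" by (simp add: n_def)
  then have sizes: "vsize (code_nats as) < n" "vsize (code_nats qs) < n" "vsize (code_list ds) < n" "vsize u < n"
    by (simp_all add: inp u)
  have lens: "length as < n" "length qs < n" "length ds < n"
    using sizes length_less_vsize[of "map code_nat as"] length_less_vsize[of "map code_nat qs"]
      length_less_vsize[of ds] by simp_all
  have E: "length ?ss \<le> E" "1 \<le> E"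
    using lens by (simp_all add: length_subseqs E_def)
  have E1: "E \<le> E ^ 4" "E * E \<le> E ^ 4" "E * E * E \<le> E ^ 4" "1 \<le> E ^ 4"
    using E power_increasing[of 1 4 E] power_increasing[of 2 4 E] power_increasing[of 3 4 E]
    by (simp_all add: power2_eq_square power3_eq_cube)
  have sub: "\<forall>s \<in> set ?ss. vsize (code_nats s) \<le> n"
    using vsize_subseqs[of _ as] sizes by fastforce
  have ss: "vsize (code_list (map code_nats ?ss)) \<le> 10 * E ^ 4"
  proof -
    have "vsize (code_list (map code_nats ?ss)) \<le> Suc (length (map code_nats ?ss) * Suc n)"
      using sub by (intro vsize_code_list_le) auto
    also have "length (map code_nats ?ss) * Suc n \<le> E * E"
      using E n by (intro mult_le_mono) auto
    finally show ?thesis using E1 by linarith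
  qed
  have trans: "vsize (code_list (map (\<lambda>s. Pr Nl (Pr s Nl)) (map code_nats ?ss))) \<le> 10 * E ^ 4"
  proof -
    have "vsize (code_list (map (\<lambda>s. Pr Nl (Pr s Nl)) (map code_nats ?ss)))
       \<le> Suc (length (map (\<lambda>s. Pr Nl (Pr s Nl)) (map code_nats ?ss)) * Suc (n + 4))"
      using sub by (intro vsize_code_list_le) auto
    also have "length (map (\<lambda>s. Pr Nl (Pr s Nl)) (map code_nats ?ss)) * Suc (n + 4) \<le> E * (5 * E)"
      using E n by (intro mult_le_mono) auto
    finally show ?thesis using E1 by linarith
  qed
  have diag: "vsize (diagonal_code qs as) \<le> 10 * E ^ 4"
  proof -
    have member: "vsize (code_nat b) < vsize (code_nats bs)" if "b \<in> set bs" for b bs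
      using that by (intro vsize_member) auto
    have "vsize (diagonal_code qs as) \<le> Suc (length (concat
      (map (\<lambda>q. map (\<lambda>a. Pr q (Pr a a)) (map code_nat as)) (map code_nat qs))) * Suc (3 * n + 2))"
    proof (rule vsize_code_list_le)
      fix d assume "d \<in> set (concat (map (\<lambda>q. map (\<lambda>a. Pr q (Pr a a)) (map code_nat as)) (map code_nat qs)))"
      then obtain q a where "d = Pr (code_nat q) (Pr (code_nat a) (code_nat a))" "q \<in> set qs" "a \<in> set as"
        by auto
      then show "vsize d \<le> 3 * n + 2"
        using member[of q qs] member[of a as] sizes by simp
    qed
    also have "length (concat (map (\<lambda>q. map (\<lambda>a. Pr q (Pr a a)) (map code_nat as)) (map code_nat qs)))
        = length qs * length as"
      by (induction qs) auto
    also have "length qs * length as * Suc (3 * n + 2) \<le> E * E * (3 * E)"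
      using lens n by (intro mult_le_mono) auto
    finally show ?thesis using E1 by linarith
  qed
  have form: "Suc (length ds) * (Suc (length ?ss) * (4 * n + 60)) \<le> 200 * E ^ 4"
  proof -
    have "Suc (length ds) * (Suc (length ?ss) * (4 * n + 60)) \<le> E * (2 * E * (64 * E))"
      using lens n E by (intro mult_le_mono) auto
    then show ?thesis using E1 by linarith
  qed
  have W: "W \<ge> 1000" "20 * n \<le> W"
    using E1 n unfolding W_def by linarith+
  obtain e m1 where e: "e \<in> codes_qfree codes_var (constrs_formula ?ss gs)" "vsize e \<le> 200 * E ^ 4"
    and m1: "m1 \<le> Suc (length ds) * ((100 * Suc n * Suc n + 300) * Suc (length ?ss) * W)"
      "eval prog [code_list ds, code_list (map code_nats ?ss)] (prog ! 12) e m1"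
  proof -
    have "vsize (code_list ds) \<le> n" "vsize (code_list (map code_nats ?ss)) \<le> W"
      "Suc (length ds) * (Suc (length ?ss) * (4 * n + 60)) \<le> W"
      using sizes ss form unfolding W_def by linarith+
    from eval_formula[OF ds this(1) sub this(2,3)] form that show ?thesis
      by (meson order_trans)
  qed
  obtain m2 where m2: "m2 \<le> 100 * 4 ^ length as * W"
      "eval prog [code_nats as] (prog ! 5) (code_list (map code_nats ?ss)) m2"
  proof -
    have "map code_list (subseqs (map code_nat as)) = map code_nats ?ss"
      by (simp add: subseqs_map)
    moreover have "vsize (code_nats as) \<le> W" "vsize (code_list (map code_nats ?ss)) \<le> W"
      using sizes ss W unfolding W_def by linarith+
    ultimately show ?thesis
      using eval_subs[of "map code_nat as" W] that by auto
  qed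
  obtain m3 where m3: "m3 \<le> 100 * Suc (length as) * Suc (length qs) * W"
      "eval prog [code_nats qs, code_nats as] (prog ! 3) (diagonal_code qs as) m3"
  proof -
    have "vsize (code_nats as) \<le> W" "vsize (code_nats qs) \<le> W" "vsize (diagonal_code qs as) \<le> W"
      using sizes diag W unfolding W_def by linarith+
    then show ?thesis
      using eval_prod[of "map code_nat qs" W "map code_nat as"] that by (auto simp del: map_map)
  qed
  obtain m4 where m4: "m4 \<le> 40 * Suc (length ?ss) * W"
      "eval prog [code_list (map code_nats ?ss)] (prog ! 6)
        (code_list (map (\<lambda>s. Pr Nl (Pr s Nl)) (map code_nats ?ss))) m4"
  proof -
    have "vsize (code_list (map (\<lambda>s. Pr Nl (Pr s Nl)) (map code_nats ?ss))) \<le> W"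
      using trans unfolding W_def by linarith
    then show ?thesis
      using eval_trans[of "map code_nats ?ss" W] that by (auto simp del: map_map)
  qed
  note [simp] = eval_iff[OF m1(2)] eval_iff[OF m2(2)] eval_iff[OF m3(2)] eval_iff[OF m4(2)]
  let ?out = "Pr (Pr (Pr u (Pr (code_nats as) (diagonal_code qs as)))
         (Pr (nfa_code ?ss) Nl)) e"
  have Wsizes: "vsize u \<le> W" "vsize (code_nats as) \<le> W" "vsize (code_nats qs) \<le> W" "vsize inp \<le> W"
    "vsize (code_list ds) \<le> W" "vsize (code_list (map code_nats ?ss)) \<le> W"
    using sizes W ss by (simp_all add: n_def W_def)
  have outW: "vsize ?out \<le> W"
    using e(2) trans diag sizes n E1 W_def by simp
  have "\<exists>m \<le> m1 + m3 + m4 + 100 * W.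
    eval prog [u, code_list ds, code_list (map code_nats ?ss)] (prog ! 1) ?out m"
    using outW Wsizes
    by (subst (2) prog_def) (simp add: u eval_simps evals_simps)
  then obtain m5 where m5: "m5 \<le> m1 + m3 + m4 + 100 * W"
    "eval prog [u, code_list ds, code_list (map code_nats ?ss)] (prog ! 1) ?out m5" by blast
  obtain m6 where m6: "m6 \<le> m5 + m2 + 100 * W" "computes prog inp ?out m6"
    using eval_main[OF m2(2) m5(2)[unfolded u], of W] Wsizes that by (auto simp: inp u)
  have b1: "m1 \<le> 1400 * (E ^ 4 * W)"
  proof -
    have "Suc (length ds) * ((100 * Suc n * Suc n + 300) * Suc (length ?ss) * W)
       \<le> E * ((100 * E * E + 300 * E * E) * (2 * E) * W)"
      using lens n E by (intro mult_le_mono add_mono order_refl) auto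
    also have "\<dots> = 800 * (E ^ 4 * W)" by (simp add: power4_eq_xxxx algebra_simps)
    finally show ?thesis using m1 by linarith
  qed
  have b2: "m2 \<le> 100 * (E ^ 4 * W)"
  proof -
    have "(4::nat) ^ length as = 2 ^ length as * 2 ^ length as"
      by (simp add: power_mult_distrib[symmetric])
    also have "\<dots> \<le> E * E"
      using lens by (intro mult_le_mono) (simp_all add: E_def)
    also have "\<dots> \<le> E ^ 4" by (rule E1)
    finally have "100 * 4 ^ length as * W \<le> 100 * E ^ 4 * W"
      by (intro mult_le_mono order_refl)
    then show ?thesis using m2(1) unfolding mult.assoc by linarith
  qed
  have b3: "m3 \<le> 100 * (E ^ 4 * W)"
  proof -
    have "Suc (length as) * Suc (length qs) \<le> E * E"
      using lens n by (intro mult_le_mono) auto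
    also have "\<dots> \<le> E ^ 4" by (rule E1)
    finally have "100 * (Suc (length as) * Suc (length qs)) * W \<le> 100 * E ^ 4 * W"
      by (intro mult_le_mono order_refl)
    then show ?thesis using m3(1) unfolding mult.assoc by linarith
  qed
  have b4: "m4 \<le> 80 * (E ^ 4 * W)"
  proof -
    have "Suc (length ?ss) \<le> E ^ 4 + E ^ 4"
      using E(1) E1(1,4) by linarith
    then have "40 * Suc (length ?ss) \<le> 80 * E ^ 4"
      by simp
    then have "40 * Suc (length ?ss) * W \<le> 80 * E ^ 4 * W"
      by (rule mult_le_mono1)
    then show ?thesis using m4(1) unfolding mult.assoc by linarith
  qed
  have "W \<le> E ^ 4 * W" using E1(4) by simp
  with b1 b2 b3 b4 m5 m6 have "m6 \<le> 2000 * (E ^ 4 * W)" by linarith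
  also have "\<dots> = 2000000 * E ^ 8"
    by (simp add: W_def power_add[symmetric])
  also have "\<dots> \<le> 2 ^ 22 * E ^ 22"
    using E by (intro mult_le_mono power_increasing) auto
  also have "\<dots> = 2 ^ (22 * vsize inp + 22)"
    by (simp add: E_def n_def power_mult[symmetric] power_add mult.commute)
  finally show ?thesis using e(1) m6(2) by blast
qed

lemma codes_setI: "set xs = X \<Longrightarrow> (\<And>x. x \<in> X \<Longrightarrow> f x \<in> c x) \<Longrightarrow> code_list (map f xs) \<in> codes_set c X"
  unfolding codes_set_def by (auto intro!: bexI[of _ xs] codes_listI)

lemma id_wodta_codes:
  assumes u: "u \<in> codes_uta A" and as: "set as = uta_alph A" and qs: "set qs = uta_states A"
  shows "Pr (Pr u (Pr (code_nats as) (diagonal_code qs as))) (Pr (nfa_code (subseqs as)) Nl)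
    \<in> codes_wodta (id_wodta A)"
proof -
  have "diagonal_code qs as = code_list (map (\<lambda>(q, a, b). Pr (code_nat q) (Pr (code_nat a) (code_nat b)))
      (concat (map (\<lambda>q. map (\<lambda>a. (q, a, a)) as) qs)))"
    by (simp add: map_concat comp_def)
  also have "\<dots> \<in> codes_set (codes_prod codes_nat (codes_prod codes_nat codes_nat))
      {(q, a, a) | q a. q \<in> uta_states A \<and> a \<in> uta_alph A}"
    by (intro codes_setI) (auto simp: as qs codes_prod_def pairs_def codes_nat_def)
  finally have diag: "diagonal_code qs as \<in> \<dots>" .
  have "code_list (map (\<lambda>s. Pr Nl (Pr s Nl)) (map code_nats (subseqs as))) \<in>
      codes_list (codes_prod codes_nat (codes_prod (codes_set codes_nat) codes_nat))
        (map (\<lambda>s. (0, set s, 0)) (subseqs as))"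
    unfolding codes_list_map map_map
    by (intro codes_listI) (auto simp: codes_prod_def pairs_def codes_nat_def intro!: code_nats_codes)
  moreover have "set (map (\<lambda>s. (0 :: nat, set s, 0 :: nat)) (subseqs as)) = {0} \<times> Pow (uta_alph A) \<times> {0}"
  proof -
    have "set (map (\<lambda>s. (0 :: nat, set s, 0 :: nat)) ss) = {0} \<times> set ` set ss \<times> {0}" for ss :: "nat list list"
      by auto
    then show ?thesis
      using subseqs_powset[of as] by (simp only: as image_set)
  qed
  ultimately have trans: "code_list (map (\<lambda>s. Pr Nl (Pr s Nl)) (map code_nats (subseqs as))) \<in>
      codes_set (codes_prod codes_nat (codes_prod (codes_set codes_nat) codes_nat))
        ({0} \<times> Pow (uta_alph A) \<times> {0})"
    unfolding codes_set_def by blast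
  have zero: "Pr Nl Nl \<in> codes_set codes_nat {0}"
    using code_nats_codes[of "[0]" "{0}"] by simp
  have empty: "Nl \<in> codes_set codes_nat {}"
    using code_nats_codes[of "[]" "{}"] by simp
  show ?thesis
    using u diag trans zero empty code_nats_codes[OF as]
    unfolding codes_wodta_def codes_transducer_def codes_nfa_def id_wodta_def pairs_def
    by simp
qed

theorem theorem6p5:
  shows "\<exists>(P :: prog) (c :: nat) (k :: nat).
    \<forall>(A :: nat uta) (C :: nat constr set).
      wf_uta A \<longrightarrow> finite C \<longrightarrow> (\<forall>\<gamma> \<in> C. constr_over (uta_alph A) \<gamma>) \<longrightarrow>
      (\<forall>inp \<in> codes_input A C.
        \<exists>(S :: (nat, nat) wodta) (\<phi> :: nat cvar expresb).
          wf_ext_wodta (uta_alph A) S \<phi> \<and>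
          {t \<in> odtrees_over (uta_alph A). ext_wodta_accepts S \<phi> t} =
          {t \<in> odtrees_over (uta_alph A). uta_accepts A (Proj t) \<and>
             (\<forall>\<gamma> \<in> C. constr_sat (uta_alph A) t \<gamma>)} \<and>
          (\<exists>out \<in> codes_output S \<phi>. \<exists>time.
             computes P inp out time \<and> time \<le> 2 ^ (c * vsize inp ^ k + c)))"
proof (rule exI[of _ prog], rule exI[of _ 22], rule exI[of _ 1], intro allI impI ballI)
  fix A :: "nat uta" and C :: "nat constr set" and inp
  assume A: "wf_uta A" and over: "\<forall>\<gamma> \<in> C. constr_over (uta_alph A) \<gamma>"
    and "inp \<in> codes_input A C"
  then obtain u ds gs where inp: "inp = Pr u (code_list ds)" and u: "u \<in> codes_uta A"
    and ds: "list_all2 (\<lambda>d g. d \<in> codes_constr g) ds gs" and gs: "set gs = C"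
    by (auto simp: codes_input_def pairs_def codes_set_def codes_list_def)
  from u obtain as qs v where u': "u = Pr (code_nats as) (Pr (code_nats qs) v)"
    and as: "set as = uta_alph A" and qs: "set qs = uta_states A"
    unfolding codes_uta_def pairs_def codes_set_codes_nat by blast
  let ?\<phi> = "Ex_prefix (constrs_formula (subseqs as) gs)"
  have ss: "set ` set (subseqs as) = Pow (uta_alph A)"
    using subseqs_powset[of as] by (simp add: as)
  obtain e m where e: "e \<in> codes_qfree codes_var (constrs_formula (subseqs as) gs)"
    and m: "m \<le> 2 ^ (22 * vsize inp + 22)" "computes prog inp
      (Pr (Pr (Pr u (Pr (code_nats as) (diagonal_code qs as)))
         (Pr (nfa_code (subseqs as)) Nl)) e) m"
    using computes_output[OF inp u' ds] by blast
  have "wf_ext_wodta (uta_alph A) (id_wodta A) ?\<phi>"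
    using over gs by (intro wf_id_wodta[OF A] free_vars_constrs_formula[OF ss]) auto
  moreover have "ext_wodta_accepts (id_wodta A) ?\<phi> t \<longleftrightarrow>
      uta_accepts A (Proj t) \<and> (\<forall>\<gamma> \<in> C. constr_sat (uta_alph A) t \<gamma>)"
    if "t \<in> odtrees_over (uta_alph A)" for t
    using that over gs
    by (simp add: id_wodta_accepts expresb_sat_def constrs_formula_sat lin_sat_constr_lin[OF that ss])
  moreover have "Pr (Pr (Pr u (Pr (code_nats as) (diagonal_code qs as)))
         (Pr (nfa_code (subseqs as)) Nl)) e \<in> codes_output (id_wodta A) ?\<phi>"
    using id_wodta_codes[OF u as qs] e by (auto simp: codes_output_def codes_expresb_def pairs_def)
  ultimately show "\<exists>S \<phi>.
          wf_ext_wodta (uta_alph A) S \<phi> \<and>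
          {t \<in> odtrees_over (uta_alph A). ext_wodta_accepts S \<phi> t} =
          {t \<in> odtrees_over (uta_alph A). uta_accepts A (Proj t) \<and>
             (\<forall>\<gamma> \<in> C. constr_sat (uta_alph A) t \<gamma>)} \<and>
          (\<exists>out \<in> codes_output S \<phi>. \<exists>time.
             computes prog inp out time \<and> time \<le> 2 ^ (22 * vsize inp ^ 1 + 22))"
    using m unfolding power_one_right
    by (intro exI[of _ "id_wodta A"] exI[of _ ?\<phi>]) blast
qed

end
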